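(* There is no stable base $\mathcal{B}$ such that the law $A\Rightarrow_\rho C,\ B\Rightarrow_\rho C,\ A\vee B\ \vdash_\rho\ C$ holds (i.e. is true for all algorithmic statements $A,B,C$) for all $\mathcal{B}$-libraries $\rho$. In particular, no stable base contains Rule $P_4$, the rule implementing the diagram $A\Rightarrow_\rho C,\ B\Rightarrow_\rho C,\ A\vee B\,/\,C$.
   Context: Framework. Algorithms are recursive algorithms in a fixed standard model. A datum is anything that can be input to an algorithm; data include natural numbers and algorithms, and every finite list of data is a datum. Every algorithm accepts exactly one input datum and either does not halt or halts with exactly one output datum. Every datum has a positive integer size, only finitely many data have a given size, and the size of a list is strictly greater than the sum of the sizes of its items. A process is a pair (algorithm, input). Every halting process has a positive integer runtime; if a process runs subprocesses in its execution, its runtime is strictly greater than the sum of the runtimes of the halting subprocesses. An algorithmic statement is a datum $[\alpha,u,v]$ with $\alpha$ an algorithm, asserting that $\alpha$ with input $u$ halts with output $v$; it is true if this is so and false otherwise, and it is directly false if $\alpha$ halts on $u$ with an output different from $v$. To say that an algorithmic statement holds is to say that it is true. Rules and libraries. An algorithmic sequence is an algorithm $\rho$ that halts on every positive integer $n$; its output is written $\rho_n$. A rule is an algorithm which, on every input $[H,\rho,m]$ with $H$ a finite list of algorithmic statements (hypothesis list), $\rho$ an algorithmic sequence (nominal library) and $m$ a positive integer (resource integer), halts and outputs a list of algorithmic statements (conclusion list) having $H$ as an initial sublist, and which is monotone: if $m'\ge m$ and every item of $H$ is an item of $H'$, then every item of the output on $[H,\rho,m]$ is an item of the output on $[H',\rho,m']$.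 A library is an algorithmic sequence $\rho$ such that every $\rho_n$ is a rule (not necessarily distinct); the $\rho_n$ are the rules contained in $\rho$. A rule is $\rho$-valid if for every list $H$ of true statements and every $m$, its output on $[H,\rho,m]$ consists only of true statements. A library $\rho$ is valid if all its rules are $\rho$-valid. Bases. A base is a set $\mathcal{B}$ of rules that is finite or is the set of terms of a library. A $\mathcal{B}$-library is a library containing all rules of $\mathcal{B}$. A $\mathcal{B}$-library $\rho$ is valid outside $\mathcal{B}$ if every rule in $\rho$ which is not in $\mathcal{B}$ is $\rho$-valid. A base $\mathcal{B}$ is stable if every $\mathcal{B}$-library that is valid outside $\mathcal{B}$ is valid. Deduction. Fix a recursive bijection $f:\mathbb{N}_+\to\mathbb{N}_+\times\mathbb{N}_+$. The algorithm $\mathrm{deduce}$, on input $[\Gamma,\rho,B]$ ($\Gamma$ a list of algorithmic statements, $\rho$ a library, $B$ an algorithmic statement), computes lists $H_0=\Gamma,H_1,H_2,\dots$, where for $i>0$ with $f(i)=(k,m)$ the list $H_i$ is the output of $\rho_k$ on $[H_{i-1},\rho,m]$; after computing each $H_i$ it checks whether $B$ is on $H_i$, outputs $1$ if so, and otherwise continues. The algorithmic statement $[\mathrm{deduce},[\Gamma,\rho,B],1]$ is denoted $\Gamma\vdash_\rho B$ (the notation is used for any datum $\rho$), and $A_1,\dots,A_n\vdash_\rho B$ means this with $\Gamma=[A_1,\dots,A_n]$. $A\Rightarrow_\rho B$ denotes $A\vdash_\rho B$. Disjunction. The algorithm $\mathrm{or}$ on input $[A,B]$ (two algorithmic statements)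 outputs $1$ if $A$ or $B$ is true, $0$ if both are directly false, and otherwise does not halt; $A\vee B$ denotes the statement $[\mathrm{or},[A,B],1]$. Rule diagrams. A rule implementing "$X_1,\dots,X_r\,/\,Y$" is the algorithm which on input $[H,\rho,m]$ outputs $H$ with $Y$ appended for every instance (letters $A,B,C$ ranging over algorithmic statements) whose premises $X_1,\dots,X_r$ are all on $H$; the $\rho$ in $\Rightarrow_\rho$ is the nominal library in the input. *)

theory Defs
  imports Main
begin

section \<open>The model of computation\<close>

text \<open>
  The fixed standard model: a small language of combinators on data. Algorithms are syntax trees
  and are themselves data; they can be taken apart and assembled by other algorithms
  (\<open>Quote\<close>, \<open>Unquote\<close>), run (\<open>Apply\<close>), and run for a bounded time
  (\<open>Clock\<close>, the usual step-bounded interpreter, which makes dovetailing available).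
\<close>

datatype opr = Hd | Tl | Push | Same | Incr | Decr | Kind | Quote | Unquote

datatype datum = Num nat | Lst "datum list" | Alg alg
  and alg =
    Ident
  | Const datum
  | Opr opr
  | Comp alg alg
  | Pair alg alg
  | Cond alg alg alg
  | While alg alg
  | Apply
  | Clock

text \<open>One level of the syntax tree of an algorithm, as a datum.\<close>

fun quote :: "alg \<Rightarrow> datum" where
  "quote Ident = Lst [Num 0]"
| "quote (Const d) = Lst [Num 1, d]"
| "quote (Opr p) = Lst [Num 2, Num (case p of Hd \<Rightarrow> 0 | Tl \<Rightarrow> 1 | Push \<Rightarrow> 2 | Same \<Rightarrow> 3 | Incr \<Rightarrow> 4
     | Decr \<Rightarrow> 5 | Kind \<Rightarrow> 6 | Quote \<Rightarrow> 7 | Unquote \<Rightarrow> 8)]"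
| "quote (Comp g f) = Lst [Num 3, Alg g, Alg f]"
| "quote (Pair f g) = Lst [Num 4, Alg f, Alg g]"
| "quote (Cond c f g) = Lst [Num 5, Alg c, Alg f, Alg g]"
| "quote (While c b) = Lst [Num 6, Alg c, Alg b]"
| "quote Apply = Lst [Num 7]"
| "quote Clock = Lst [Num 8]"

text \<open>The basic operations are total; on arguments of the wrong form they return the empty list.\<close>

fun prim :: "opr \<Rightarrow> datum \<Rightarrow> datum" where
  "prim Hd x = (case x of Lst (a # as) \<Rightarrow> a | _ \<Rightarrow> Lst [])"
| "prim Tl x = (case x of Lst (a # as) \<Rightarrow> Lst as | _ \<Rightarrow> Lst [])"
| "prim Push x = (case x of Lst [a, Lst as] \<Rightarrow> Lst (a # as) | _ \<Rightarrow> Lst [])"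
| "prim Same x = (case x of Lst [a, b] \<Rightarrow> Num (if a = b then 1 else 0) | _ \<Rightarrow> Lst [])"
| "prim Incr x = (case x of Num n \<Rightarrow> Num (Suc n) | _ \<Rightarrow> Lst [])"
| "prim Decr x = (case x of Num n \<Rightarrow> Num (n - 1) | _ \<Rightarrow> Lst [])"
| "prim Kind x = (case x of Num _ \<Rightarrow> Num 0 | Lst _ \<Rightarrow> Num 1 | Alg _ \<Rightarrow> Num 2)"
| "prim Quote x = (case x of Alg a \<Rightarrow> quote a | _ \<Rightarrow> Lst [])"
| "prim Unquote x = (if \<exists>a. quote a = x then Alg (THE a. quote a = x) else Lst [])"

fun process :: "datum \<Rightarrow> (alg \<times> datum) option" where
  "process (Lst [Alg a, y]) = Some (a, y)"
| "process _ = None"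

fun timed_process :: "datum \<Rightarrow> (alg \<times> datum \<times> nat) option" where
  "timed_process (Lst [Alg a, y, Num k]) = Some (a, y, k)"
| "timed_process _ = None"

definition within :: "nat \<Rightarrow> (datum \<times> nat) option \<Rightarrow> datum" where
  "within k r = (case r of Some (z, t) \<Rightarrow> if t \<le> k then Lst [z] else Lst [] | None \<Rightarrow> Lst [])"

text \<open>
  \<open>run n a x = Some (v, t)\<close>: algorithm \<open>a\<close> with input \<open>x\<close> halts with output \<open>v\<close> and runtime \<open>t\<close>,
  and \<open>n\<close> bounds the recursion depth of the evaluation. The runtime is one more than the sum of the
  runtimes of the subprocesses. In \<open>While c b\<close> the loop stops when \<open>c\<close> outputs \<open>Num 0\<close>.
\<close>

fun run :: "nat \<Rightarrow> alg \<Rightarrow> datum \<Rightarrow> (datum \<times> nat) option" where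
  "run 0 a x = None"
| "run (Suc n) Ident x = Some (x, 1)"
| "run (Suc n) (Const d) x = Some (d, 1)"
| "run (Suc n) (Opr p) x = Some (prim p x, 1)"
| "run (Suc n) (Comp g f) x =
     (case run n f x of None \<Rightarrow> None | Some (y, s) \<Rightarrow>
     (case run n g y of None \<Rightarrow> None | Some (z, t) \<Rightarrow> Some (z, Suc (s + t))))"
| "run (Suc n) (Pair f g) x =
     (case run n f x of None \<Rightarrow> None | Some (y, s) \<Rightarrow>
     (case run n g x of None \<Rightarrow> None | Some (z, t) \<Rightarrow> Some (Lst [y, z], Suc (s + t))))"
| "run (Suc n) (Cond c f g) x =
     (case run n c x of None \<Rightarrow> None | Some (y, s) \<Rightarrow>
     (case run n (if y = Num 0 then g else f) x of None \<Rightarrow> None | Some (z, t) \<Rightarrow> Some (z, Suc (s + t))))"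
| "run (Suc n) (While c b) x =
     (case run n c x of None \<Rightarrow> None | Some (y, s) \<Rightarrow>
     if y = Num 0 then Some (x, Suc s) else
     (case run n b x of None \<Rightarrow> None | Some (x', t) \<Rightarrow>
     (case run n (While c b) x' of None \<Rightarrow> None | Some (z, u) \<Rightarrow> Some (z, Suc (s + t + u)))))"
| "run (Suc n) Apply x =
     (case process x of None \<Rightarrow> None | Some (a, y) \<Rightarrow>
     (case run n a y of None \<Rightarrow> None | Some (z, t) \<Rightarrow> Some (z, Suc t)))"
| "run (Suc n) Clock x =
     (case timed_process x of None \<Rightarrow> Some (Lst [], 1) | Some (a, y, k) \<Rightarrow>
     if k \<le> n then Some (within k (run k a y), Suc k) else None)"

definition outputs :: "alg \<Rightarrow> datum \<Rightarrow> datum \<Rightarrow> bool" where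
  "outputs a x v \<longleftrightarrow> (\<exists>n t. run n a x = Some (v, t))"

definition halts :: "alg \<Rightarrow> datum \<Rightarrow> bool" where
  "halts a x \<longleftrightarrow> (\<exists>v. outputs a x v)"

definition runtime :: "alg \<Rightarrow> datum \<Rightarrow> nat" where
  "runtime a x = (THE t. \<exists>n v. run n a x = Some (v, t))"

text \<open>The sizes of data; see the lemmas \<open>dsize_Lst\<close> and \<open>finite_dsize\<close> below.\<close>

fun dsize :: "datum \<Rightarrow> nat" and asize :: "alg \<Rightarrow> nat" where
  "dsize (Num n) = Suc n"
| "dsize (Lst ds) = Suc (sum_list (map dsize ds))"
| "dsize (Alg a) = Suc (asize a)"
| "asize (Const d) = Suc (dsize d)"
| "asize (Comp g f) = Suc (asize g + asize f)"
| "asize (Pair f g) = Suc (asize f + asize g)"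
| "asize (Cond c f g) = Suc (asize c + asize f + asize g)"
| "asize (While c b) = Suc (asize c + asize b)"
| "asize a = 1"

lemma quote_inj: "quote a = quote b \<longleftrightarrow> a = b"
  by (cases a; cases b) (auto split: opr.splits)

lemma prim_Unquote_quote [simp]: "prim Unquote (quote a) = Alg a"
  by (auto simp: quote_inj)

lemma dsize_pos: "dsize d > 0"
  by (cases d) auto

lemma asize_pos: "asize a > 0"
  by (cases a) auto

lemma dsize_Lst: "sum_list (map dsize ds) < dsize (Lst ds)"
  by simp

lemma finite_dsize_aux: "finite {d. dsize d \<le> n} \<and> finite {a. asize a \<le> n}"
proof (induction n)
  case 0
  have "{d. dsize d \<le> 0} = {}" "{a. asize a \<le> 0} = {}"
    using dsize_pos asize_pos by (metis (lifting) Collect_empty_eq not_le)+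
  then show ?case by (simp only: finite.emptyI simp_thms)
next
  case (Suc n)
  let ?D = "{d. dsize d \<le> n}" and ?A = "{a. asize a \<le> n}"
  have fin: "finite ?D" "finite ?A" using Suc by auto
  have len: "length ds \<le> sum_list (map dsize ds)" for ds
  proof (induction ds)
    case (Cons d ds) then show ?case using dsize_pos[of d] by simp
  qed simp
  have mem: "dsize d \<le> sum_list (map dsize ds)" if "d \<in> set ds" for d ds
    using that by (intro member_le_sum_list) auto
  let ?Ds = "Num ` {..n} \<union> Lst ` {ds. set ds \<subseteq> ?D \<and> length ds \<le> n} \<union> Alg ` ?A"
  have 1: "d \<in> ?Ds" if d: "dsize d \<le> Suc n" for d
  proof (cases d)
    case (Lst ds)
    with d have "sum_list (map dsize ds) \<le> n" by simp
    then have "length ds \<le> n" "set ds \<subseteq> ?D" using len[of ds] mem[of _ ds] by (auto intro: order_trans)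
    then show ?thesis unfolding Lst by blast
  qed (use d in auto)
  have 2: "finite ?Ds"
    using fin finite_lists_length_le[OF fin(1)] by auto
  have 3: "finite {d. dsize d \<le> Suc n}"
    by (rule finite_subset[OF _ 2]) (use 1 in blast)
  let ?As = "{Ident, Apply, Clock} \<union> Const ` ?D \<union> range Opr
      \<union> (\<lambda>(f, g). Comp f g) ` (?A \<times> ?A) \<union> (\<lambda>(f, g). Pair f g) ` (?A \<times> ?A)
      \<union> (\<lambda>(f, g). While f g) ` (?A \<times> ?A) \<union> (\<lambda>(c, f, g). Cond c f g) ` (?A \<times> ?A \<times> ?A)"
  have 4: "{a. asize a \<le> Suc n} \<subseteq> ?As"
  proof (intro subsetI; elim CollectE)
    fix a assume "asize a \<le> Suc n"
    then show "a \<in> ?As"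
    proof (cases a)
      case (Cond c f g)
      with \<open>asize a \<le> Suc n\<close> have "(c, f, g) \<in> ?A \<times> ?A \<times> ?A" by simp
      then have "Cond c f g \<in> (\<lambda>(c, f, g). Cond c f g) ` (?A \<times> ?A \<times> ?A)" by (rule rev_image_eqI) simp
      then show ?thesis unfolding Cond by (intro UnI2)
    qed (auto simp: image_iff)
  qed
  have 5: "finite ?As"
  proof -
    have "UNIV = {Hd, Tl, Push, Same, Incr, Decr, Kind, Quote, Unquote}"
      using opr.exhaust by (intro UNIV_eq_I) blast
    then have "finite (UNIV :: opr set)" by (metis finite.emptyI finite_insert)
    then have "finite (range Opr)" by (rule finite_imageI)
    then show ?thesis using fin by simp
  qed
  show ?case using 3 finite_subset[OF 4 5] by blast
qed

lemma finite_dsize: "finite {d. dsize d = n}"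
  using finite_dsize_aux[of n] by (auto elim: rev_finite_subset)

lemma case_option_eq_SomeE:
  assumes "(case u of None \<Rightarrow> None | Some p \<Rightarrow> F p) = Some r"
  obtains p where "u = Some p" "F p = Some r"
  using assms by (cases u) auto

lemma run_mono: "run n a x = Some r \<Longrightarrow> n \<le> m \<Longrightarrow> run m a x = Some r"
proof (induction n arbitrary: a x m r)
  case (Suc n)
  from Suc.prems(2) obtain m' where m: "m = Suc m'" "n \<le> m'" by (cases m) auto
  have IH: "run n b y = Some s \<Longrightarrow> run m' b y = Some s" for b y s
    using Suc.IH m(2) by blast
  note R = Suc.prems(1)
  show ?case
  proof (cases a)
    case Clock
    with R m show ?thesis by (auto split: option.splits if_splits)
  qed (use R m in \<open>auto elim!: case_option_eq_SomeE split: if_splits dest!: IH\<close>)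
qed simp

lemma run_det: "run n a x = Some r \<Longrightarrow> run m a x = Some s \<Longrightarrow> r = s"
  using run_mono[of n a x r m] run_mono[of m a x s n] by (cases "n \<le> m") auto

lemma outputs_det: "outputs a x v \<Longrightarrow> outputs a x w \<Longrightarrow> v = w"
  unfolding outputs_def by (auto dest: run_det)

lemma run_fuel: "run n a x = Some (v, t) \<Longrightarrow> run t a x = Some (v, t)"
proof (induction n arbitrary: a x v t)
  case (Suc n)
  have IH: "run n b y = Some (w, s) \<Longrightarrow> s \<le> u \<Longrightarrow> run u b y = Some (w, s)" for b y w s u
    using Suc.IH run_mono by blast
  note R = Suc.prems
  show ?case
  proof (cases a)
    case (Comp g f)
    from R obtain y s u where *: "run n f x = Some (y, s)" "run n g y = Some (v, u)" "t = Suc (s + u)"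
      unfolding Comp by (auto elim!: case_option_eq_SomeE)
    show ?thesis unfolding Comp *(3) using IH[OF *(1), of "s + u"] IH[OF *(2), of "s + u"] by simp
  next
    case (Pair f g)
    from R obtain y z s u where *: "run n f x = Some (y, s)" "run n g x = Some (z, u)"
      "t = Suc (s + u)" "v = Lst [y, z]"
      unfolding Pair by (auto elim!: case_option_eq_SomeE)
    show ?thesis unfolding Pair *(3,4) using IH[OF *(1), of "s + u"] IH[OF *(2), of "s + u"] by simp
  next
    case (Cond c f g)
    from R obtain y s u where *: "run n c x = Some (y, s)"
      "run n (if y = Num 0 then g else f) x = Some (v, u)" "t = Suc (s + u)"
      unfolding Cond by (auto elim!: case_option_eq_SomeE)
    show ?thesis unfolding Cond *(3) using IH[OF *(1), of "s + u"] IH[OF *(2), of "s + u"]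
      by simp
  next
    case (While c b)
    from R obtain y s where 1: "run n c x = Some (y, s)" "(if y = Num 0 then Some (x, Suc s) else
       (case run n b x of None \<Rightarrow> None | Some (x', t) \<Rightarrow>
       (case run n (While c b) x' of None \<Rightarrow> None | Some (z, u) \<Rightarrow> Some (z, Suc (s + t + u))))) = Some (v, t)"
      unfolding While by (auto elim!: case_option_eq_SomeE)
    show ?thesis
    proof (cases "y = Num 0")
      case True
      with 1 IH[OF 1(1) order_refl] show ?thesis unfolding While by auto
    next
      case False
      with 1(2) obtain x' t' u where *: "run n b x = Some (x', t')"
        "run n (While c b) x' = Some (v, u)" "t = Suc (s + t' + u)"
        by (auto elim!: case_option_eq_SomeE)
      show ?thesis unfolding While *(3) using False IH[OF 1(1), of "s + t' + u"]
          IH[OF *(1), of "s + t' + u"] IH[OF *(2), of "s + t' + u"] by simp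
    qed
  next
    case Apply
    from R obtain b y u where *: "process x = Some (b, y)" "run n b y = Some (v, u)" "t = Suc u"
      unfolding Apply by (auto elim!: case_option_eq_SomeE)
    show ?thesis unfolding Apply *(3) using *(1) IH[OF *(2) order_refl] by simp
  next
    case Clock
    with R show ?thesis by (auto split: option.splits if_splits)
  qed (use R in auto)
qed simp

lemma runtime_eq:
  assumes "run n a x = Some (v, t)"
  shows "runtime a x = t"
  unfolding runtime_def using assms by (auto dest: run_det)

lemma runtime_pos:
  assumes "halts a x"
  shows "runtime a x > 0"
proof -
  obtain n v t where r: "run n a x = Some (v, t)"
    using assms unfolding halts_def outputs_def by blast
  have "t > 0" using run_fuel[OF r] by (cases t) auto
  then show ?thesis using runtime_eq[OF r] by simp
qed


section \<open>Algorithmic statements, rules and libraries\<close>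

definition statements :: "datum set" where
  "statements = {Lst [Alg \<alpha>, u, v] | \<alpha> u v. True}"

definition true_stmt :: "datum \<Rightarrow> bool" where
  "true_stmt A \<longleftrightarrow> (\<exists>\<alpha> u v. A = Lst [Alg \<alpha>, u, v] \<and> outputs \<alpha> u v)"

definition directly_false :: "datum \<Rightarrow> bool" where
  "directly_false A \<longleftrightarrow> (\<exists>\<alpha> u v w. A = Lst [Alg \<alpha>, u, v] \<and> outputs \<alpha> u w \<and> w \<noteq> v)"

definition algorithmic_sequence :: "alg \<Rightarrow> bool" where
  "algorithmic_sequence \<rho> \<longleftrightarrow> (\<forall>n>0. halts \<rho> (Num n))"

definition rule_input :: "datum list \<Rightarrow> alg \<Rightarrow> nat \<Rightarrow> datum" where
  "rule_input H \<rho> m = Lst [Lst H, Alg \<rho>, Num m]"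

definition is_rule_input :: "datum list \<Rightarrow> alg \<Rightarrow> nat \<Rightarrow> bool" where
  "is_rule_input H \<rho> m \<longleftrightarrow> set H \<subseteq> statements \<and> algorithmic_sequence \<rho> \<and> m > 0"

definition is_rule :: "alg \<Rightarrow> bool" where
  "is_rule r \<longleftrightarrow>
     (\<forall>H \<rho> m. is_rule_input H \<rho> m \<longrightarrow>
        (\<exists>K. set K \<subseteq> statements \<and> outputs r (rule_input H \<rho> m) (Lst (H @ K)))) \<and>
     (\<forall>H H' \<rho> m m' L L'. is_rule_input H \<rho> m \<and> is_rule_input H' \<rho> m' \<and> m \<le> m' \<and> set H \<subseteq> set H' \<and>
        outputs r (rule_input H \<rho> m) (Lst L) \<and> outputs r (rule_input H' \<rho> m') (Lst L') \<longrightarrow>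
        set L \<subseteq> set L')"

definition is_library :: "alg \<Rightarrow> bool" where
  "is_library \<rho> \<longleftrightarrow> (\<forall>n>0. \<exists>r. is_rule r \<and> outputs \<rho> (Num n) (Alg r))"

definition rules_of :: "alg \<Rightarrow> alg set" where
  "rules_of \<rho> = {r. \<exists>n>0. outputs \<rho> (Num n) (Alg r)}"

definition valid_rule :: "alg \<Rightarrow> alg \<Rightarrow> bool" where
  "valid_rule \<rho> r \<longleftrightarrow>
     (\<forall>H m L. (\<forall>A\<in>set H. true_stmt A) \<and> m > 0 \<and> outputs r (rule_input H \<rho> m) (Lst L) \<longrightarrow>
        (\<forall>A\<in>set L. true_stmt A))"

definition valid_library :: "alg \<Rightarrow> bool" where
  "valid_library \<rho> \<longleftrightarrow> (\<forall>r\<in>rules_of \<rho>. valid_rule \<rho> r)"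

section \<open>Bases\<close>

definition is_base :: "alg set \<Rightarrow> bool" where
  "is_base \<B> \<longleftrightarrow> (\<forall>r\<in>\<B>. is_rule r) \<and> (finite \<B> \<or> (\<exists>\<rho>. is_library \<rho> \<and> \<B> = rules_of \<rho>))"

definition base_library :: "alg set \<Rightarrow> alg \<Rightarrow> bool" where
  "base_library \<B> \<rho> \<longleftrightarrow> is_library \<rho> \<and> \<B> \<subseteq> rules_of \<rho>"

definition valid_outside :: "alg set \<Rightarrow> alg \<Rightarrow> bool" where
  "valid_outside \<B> \<rho> \<longleftrightarrow> (\<forall>r \<in> rules_of \<rho> - \<B>. valid_rule \<rho> r)"

definition stable :: "alg set \<Rightarrow> bool" where
  "stable \<B> \<longleftrightarrow> is_base \<B> \<and>
     (\<forall>\<rho>. base_library \<B> \<rho> \<and> valid_outside \<B> \<rho> \<longrightarrow> valid_library \<rho>)"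

section \<open>Deduction and disjunction\<close>

text \<open>
  The algorithms \<open>deduce\<close> and \<open>or\<close> are specified by their input-output behaviour, on the inputs on
  which they are described; such algorithms exist by \<open>ex_is_deduce\<close> and \<open>ex_is_or\<close> below.
\<close>

definition recursive_enumeration :: "(nat \<Rightarrow> nat \<times> nat) \<Rightarrow> bool" where
  "recursive_enumeration f \<longleftrightarrow> bij_betw f {0<..} ({0<..} \<times> {0<..}) \<and>
     (\<exists>\<phi>. \<forall>i>0. outputs \<phi> (Num i) (Lst [Num (fst (f i)), Num (snd (f i))]))"

text \<open>The lists \<open>H\<^sub>0, H\<^sub>1, \<dots>\<close>; the description operator is meaningful when \<open>\<rho>\<close> is a library,
  see \<open>deduction_Suc\<close> below.\<close>

primrec deduction :: "(nat \<Rightarrow> nat \<times> nat) \<Rightarrow> datum list \<Rightarrow> alg \<Rightarrow> nat \<Rightarrow> datum list" where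
  "deduction f \<Gamma> \<rho> 0 = \<Gamma>"
| "deduction f \<Gamma> \<rho> (Suc i) =
     (THE L. \<exists>r. outputs \<rho> (Num (fst (f (Suc i)))) (Alg r) \<and>
        outputs r (rule_input (deduction f \<Gamma> \<rho> i) \<rho> (snd (f (Suc i)))) (Lst L))"

definition is_deduce :: "(nat \<Rightarrow> nat \<times> nat) \<Rightarrow> alg \<Rightarrow> bool" where
  "is_deduce f ded \<longleftrightarrow>
     (\<forall>\<Gamma> \<rho> B. set \<Gamma> \<subseteq> statements \<and> is_library \<rho> \<and> B \<in> statements \<longrightarrow>
        (\<forall>v. outputs ded (Lst [Lst \<Gamma>, Alg \<rho>, B]) v \<longleftrightarrow>
               v = Num 1 \<and> (\<exists>i>0. B \<in> set (deduction f \<Gamma> \<rho> i))))"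

definition entails :: "alg \<Rightarrow> datum list \<Rightarrow> datum \<Rightarrow> datum \<Rightarrow> datum" where
  "entails ded \<Gamma> \<rho> B = Lst [Alg ded, Lst [Lst \<Gamma>, \<rho>, B], Num 1]"

definition implies :: "alg \<Rightarrow> datum \<Rightarrow> datum \<Rightarrow> datum \<Rightarrow> datum" where
  "implies ded A \<rho> B = entails ded [A] \<rho> B"

definition is_or :: "alg \<Rightarrow> bool" where
  "is_or or_alg \<longleftrightarrow>
     (\<forall>A\<in>statements. \<forall>B\<in>statements. \<forall>v. outputs or_alg (Lst [A, B]) v \<longleftrightarrow>
        v = Num 1 \<and> (true_stmt A \<or> true_stmt B) \<or>
        v = Num 0 \<and> directly_false A \<and> directly_false B)"

definition disj :: "alg \<Rightarrow> datum \<Rightarrow> datum \<Rightarrow> datum" where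
  "disj or_alg A B = Lst [Alg or_alg, Lst [A, B], Num 1]"

section \<open>Rule diagrams\<close>

text \<open>
  A diagram is given by its instances \<open>(Xs, Y)\<close>, premises and conclusion, for each nominal library.
  The order in which the conclusions are appended is left open. An algorithm implementing
  \<open>P4_diagram\<close> exists by \<open>ex_implements_P4\<close> below.
\<close>

definition implements :: "(alg \<Rightarrow> (datum list \<times> datum) set) \<Rightarrow> alg \<Rightarrow> bool" where
  "implements \<D> r \<longleftrightarrow>
     (\<forall>H \<rho> m. is_rule_input H \<rho> m \<longrightarrow>
        (\<exists>K. outputs r (rule_input H \<rho> m) (Lst (H @ K)) \<and>
             set K = {Y. \<exists>Xs. (Xs, Y) \<in> \<D> \<rho> \<and> set Xs \<subseteq> set H}))"

definition P4_diagram :: "alg \<Rightarrow> alg \<Rightarrow> alg \<Rightarrow> (datum list \<times> datum) set" where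
  "P4_diagram ded or_alg \<rho> =
     {([implies ded A (Alg \<rho>) C, implies ded B (Alg \<rho>) C, disj or_alg A B], C) | A B C.
        A \<in> statements \<and> B \<in> statements \<and> C \<in> statements}"


section \<open>Existence of the algorithms\<close>

subsection \<open>Input-output behaviour of the constructs\<close>

lemma outputs_Suc: "outputs a x v \<longleftrightarrow> (\<exists>n t. run (Suc n) a x = Some (v, t))"
  unfolding outputs_def using run_mono[of _ a x _ "Suc _", OF _ le_SucI[OF order_refl]] by blast

lemma outputs_Ident [simp]: "outputs Ident x v \<longleftrightarrow> v = x"
  and outputs_Const [simp]: "outputs (Const d) x v \<longleftrightarrow> v = d"
  and outputs_Opr [simp]: "outputs (Opr p) x v \<longleftrightarrow> v = prim p x"
  by (auto simp: outputs_Suc)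

lemma outputs_max:
  assumes "outputs a x v" "outputs b y w"
  obtains n s t where "run n a x = Some (v, s)" "run n b y = Some (w, t)"
proof -
  obtain k s l t where "run k a x = Some (v, s)" "run l b y = Some (w, t)"
    using assms unfolding outputs_def by blast
  then have "run (max k l) a x = Some (v, s)" "run (max k l) b y = Some (w, t)"
    by (auto elim: run_mono)
  then show ?thesis by (rule that)
qed

lemma outputs_Comp [simp]: "outputs (Comp g f) x v \<longleftrightarrow> (\<exists>y. outputs f x y \<and> outputs g y v)"
proof
  assume "outputs (Comp g f) x v"
  then show "\<exists>y. outputs f x y \<and> outputs g y v"
    unfolding outputs_Suc[of "Comp g f"] unfolding outputs_def
    by (auto elim!: case_option_eq_SomeE)
next
  assume "\<exists>y. outputs f x y \<and> outputs g y v"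
  then obtain y n s t where "run n f x = Some (y, s)" "run n g y = Some (v, t)"
    by (blast elim: outputs_max)
  then have "run (Suc n) (Comp g f) x = Some (v, Suc (s + t))" by simp
  then show "outputs (Comp g f) x v" unfolding outputs_def by blast
qed

lemma outputs_Pair [simp]:
  "outputs (Pair f g) x v \<longleftrightarrow> (\<exists>y z. outputs f x y \<and> outputs g x z \<and> v = Lst [y, z])"
proof
  assume "outputs (Pair f g) x v"
  then show "\<exists>y z. outputs f x y \<and> outputs g x z \<and> v = Lst [y, z]"
    unfolding outputs_Suc[of "Pair f g"] unfolding outputs_def
    by (auto elim!: case_option_eq_SomeE)
next
  assume "\<exists>y z. outputs f x y \<and> outputs g x z \<and> v = Lst [y, z]"
  then obtain y z n s t where "run n f x = Some (y, s)" "run n g x = Some (z, t)" "v = Lst [y, z]"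
    by (blast elim: outputs_max)
  then have "run (Suc n) (Pair f g) x = Some (v, Suc (s + t))" by simp
  then show "outputs (Pair f g) x v" unfolding outputs_def by blast
qed

lemma outputs_Cond [simp]:
  "outputs (Cond c f g) x v \<longleftrightarrow> (\<exists>y. outputs c x y \<and> outputs (if y = Num 0 then g else f) x v)"
proof
  assume "outputs (Cond c f g) x v"
  then obtain n t where "run (Suc n) (Cond c f g) x = Some (v, t)" unfolding outputs_Suc by blast
  then obtain y s u where "run n c x = Some (y, s)" "run n (if y = Num 0 then g else f) x = Some (v, u)"
    by (auto elim!: case_option_eq_SomeE)
  then show "\<exists>y. outputs c x y \<and> outputs (if y = Num 0 then g else f) x v"
    unfolding outputs_def by blast
next
  assume "\<exists>y. outputs c x y \<and> outputs (if y = Num 0 then g else f) x v"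
  then obtain y n s t where "run n c x = Some (y, s)" "run n (if y = Num 0 then g else f) x = Some (v, t)"
    by (blast elim: outputs_max)
  then have "run (Suc n) (Cond c f g) x = Some (v, Suc (s + t))" by simp
  then show "outputs (Cond c f g) x v" unfolding outputs_def by blast
qed

lemma outputs_While:
  "outputs (While c b) x v \<longleftrightarrow> (\<exists>y. outputs c x y \<and>
     (if y = Num 0 then v = x else \<exists>x'. outputs b x x' \<and> outputs (While c b) x' v))"
  (is "_ \<longleftrightarrow> ?R")
proof
  assume "outputs (While c b) x v"
  then obtain n t where "run (Suc n) (While c b) x = Some (v, t)" unfolding outputs_Suc by blast
  then obtain y s where y: "run n c x = Some (y, s)"
    and "(if y = Num 0 then Some (x, Suc s) else
       (case run n b x of None \<Rightarrow> None | Some (x', t) \<Rightarrow>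
       (case run n (While c b) x' of None \<Rightarrow> None | Some (z, u) \<Rightarrow> Some (z, Suc (s + t + u))))) = Some (v, t)"
    by (auto elim!: case_option_eq_SomeE)
  then have "if y = Num 0 then v = x else \<exists>x' t' u. run n b x = Some (x', t') \<and> run n (While c b) x' = Some (v, u)"
    by (auto elim!: case_option_eq_SomeE split: if_splits)
  with y show ?R unfolding outputs_def by (intro exI[of _ y]) (simp split: if_splits, blast+)
next
  assume ?R
  then obtain y where y: "outputs c x y"
    and "if y = Num 0 then v = x else \<exists>x'. outputs b x x' \<and> outputs (While c b) x' v" by blast
  show "outputs (While c b) x v"
  proof (cases "y = Num 0")
    case True
    with \<open>?R\<close> y have "v = x" by (auto dest: outputs_det)
    obtain n s where "run n c x = Some (y, s)" using y unfolding outputs_def by blast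
    then have "run (Suc n) (While c b) x = Some (v, Suc s)" using True \<open>v = x\<close> by simp
    then show ?thesis unfolding outputs_def by blast
  next
    case False
    with \<open>?R\<close> y obtain x' where "outputs b x x'" "outputs (While c b) x' v"
      by (auto dest: outputs_det split: if_splits)
    from outputs_max[OF this]
    obtain n t u where n: "run n b x = Some (x', t)" "run n (While c b) x' = Some (v, u)"
      by blast
    obtain k s where k: "run k c x = Some (y, s)" using y unfolding outputs_def by blast
    let ?m = "max k n"
    have "run ?m c x = Some (y, s)" "run ?m b x = Some (x', t)" "run ?m (While c b) x' = Some (v, u)"
      using n k by (auto elim: run_mono)
    then have "run (Suc ?m) (While c b) x = Some (v, Suc (s + t + u))" using False by simp
    then show ?thesis unfolding outputs_def by blast
  qed
qed

lemma outputs_Apply [simp]: "outputs Apply (Lst [Alg a, y]) v \<longleftrightarrow> outputs a y v"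
proof
  assume "outputs Apply (Lst [Alg a, y]) v"
  then show "outputs a y v"
    unfolding outputs_Suc[of "Apply"] unfolding outputs_def by (auto elim!: case_option_eq_SomeE)
next
  assume "outputs a y v"
  then obtain n t where "run n a y = Some (v, t)" unfolding outputs_def by blast
  then have "run (Suc n) Apply (Lst [Alg a, y]) = Some (v, Suc t)" by simp
  then show "outputs Apply (Lst [Alg a, y]) v" unfolding outputs_def by blast
qed

definition clocked :: "alg \<Rightarrow> datum \<Rightarrow> nat \<Rightarrow> datum" where
  "clocked a y k = within k (run k a y)"

definition dclock :: "datum \<Rightarrow> datum" where
  "dclock x = (case timed_process x of None \<Rightarrow> Lst [] | Some (a, y, k) \<Rightarrow> clocked a y k)"

lemma outputs_Clock: "outputs Clock x (dclock x)"
proof (cases "timed_process x")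
  case None
  then have "run (Suc 0) Clock x = Some (dclock x, 1)" by (simp add: dclock_def)
  then show ?thesis unfolding outputs_def by blast
next
  case (Some p)
  then obtain a y k where "timed_process x = Some (a, y, k)" by (cases p) auto
  then have "run (Suc k) Clock x = Some (dclock x, Suc k)" by (simp add: dclock_def clocked_def)
  then show ?thesis unfolding outputs_def by blast
qed

lemma clocked_eq_iff:
  "clocked a y k = Lst [v] \<longleftrightarrow> (\<exists>t\<le>k. run k a y = Some (v, t))"
  unfolding clocked_def within_def by (cases "run k a y") (auto split: if_splits)

lemma clocked_cases: "clocked a y k = Lst [] \<or> (\<exists>v. clocked a y k = Lst [v])"
  unfolding clocked_def within_def by (cases "run k a y") auto

lemma clocked_mono: "clocked a y k = Lst [v] \<Longrightarrow> k \<le> l \<Longrightarrow> clocked a y l = Lst [v]"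
  unfolding clocked_eq_iff by (meson run_mono order_trans)

lemma outputs_clocked: "outputs a y v \<longleftrightarrow> (\<exists>k. clocked a y k = Lst [v])"
  unfolding outputs_def clocked_eq_iff by (meson run_fuel order_refl)

lemma outputs_While_seq:
  assumes "\<And>n. (\<forall>m<n. C m \<noteq> Num 0) \<Longrightarrow> outputs c (s n) (C n)"
    and "\<And>n. (\<forall>m\<le>n. C m \<noteq> Num 0) \<Longrightarrow> outputs b (s n) (s (Suc n))"
  shows "outputs (While c b) (s 0) v \<longleftrightarrow> (\<exists>n. C n = Num 0 \<and> (\<forall>m<n. C m \<noteq> Num 0) \<and> v = s n)"
proof
  have "\<exists>n. C n = Num 0 \<and> (\<forall>m<n. C m \<noteq> Num 0) \<and> v = s n"
    if "run k (While c b) (s j) = Some (v, t)" "\<forall>m<j. C m \<noteq> Num 0" for k j t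
    using that
  proof (induction k arbitrary: j t)
    case (Suc k)
    obtain y u where y: "run k c (s j) = Some (y, u)"
      and R: "(if y = Num 0 then Some (s j, Suc u) else
       (case run k b (s j) of None \<Rightarrow> None | Some (x', t) \<Rightarrow>
       (case run k (While c b) x' of None \<Rightarrow> None | Some (z, w) \<Rightarrow> Some (z, Suc (u + t + w))))) = Some (v, t)"
      using Suc.prems(1) by (auto elim!: case_option_eq_SomeE)
    have yC: "y = C j"
      using y assms(1)[OF Suc.prems(2)] unfolding outputs_def by (auto dest: run_det)
    show ?case
    proof (cases "C j = Num 0")
      case True
      then show ?thesis using R yC Suc.prems(2) by auto
    next
      case False
      then obtain x' t' w where x': "run k b (s j) = Some (x', t')"
        "run k (While c b) x' = Some (v, w)"
        using R yC by (auto elim!: case_option_eq_SomeE)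
      have C: "\<forall>m<Suc j. C m \<noteq> Num 0" using Suc.prems(2) False less_Suc_eq by auto
      then have "outputs b (s j) (s (Suc j))" using assms(2)[of j] less_Suc_eq_le by auto
      then have "x' = s (Suc j)" using x'(1) unfolding outputs_def by (auto dest: run_det)
      then show ?thesis using Suc.IH[of "Suc j" w] x'(2) C by simp
    qed
  qed simp
  then show "\<exists>n. C n = Num 0 \<and> (\<forall>m<n. C m \<noteq> Num 0) \<and> v = s n" if "outputs (While c b) (s 0) v"
    using that unfolding outputs_def by blast
next
  assume "\<exists>n. C n = Num 0 \<and> (\<forall>m<n. C m \<noteq> Num 0) \<and> v = s n"
  then obtain n where n: "C n = Num 0" "\<forall>m<n. C m \<noteq> Num 0" "v = s n" by blast
  have "outputs (While c b) (s (n - d)) v" if "d \<le> n" for d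
    using that
  proof (induction d)
    case 0
    then show ?case
      using n assms(1)[of n] by (subst outputs_While) auto
  next
    case (Suc d)
    define j where "j = n - Suc d"
    have j: "n - d = Suc j" "j < n" using Suc.prems by (auto simp: j_def)
    have "outputs c (s j) (C j)" "outputs b (s j) (s (Suc j))" "C j \<noteq> Num 0"
      using assms[of j] n(2) j(2) by auto
    then show ?case
      using Suc j by (subst outputs_While) (auto simp: j_def[symmetric])
  qed
  from this[of n] show "outputs (While c b) (s 0) v" by simp
qed


subsection \<open>Computable total functions on data\<close>

definition computable :: "(datum \<Rightarrow> datum) \<Rightarrow> bool" where
  "computable F \<longleftrightarrow> (\<exists>a. \<forall>x. outputs a x (F x))"

fun elems :: "datum \<Rightarrow> datum list" where
  "elems (Lst ds) = ds"
| "elems _ = []"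

abbreviation dhd :: "datum \<Rightarrow> datum" where "dhd x \<equiv> prim Hd x"
abbreviation dtl :: "datum \<Rightarrow> datum" where "dtl x \<equiv> prim Tl x"
abbreviation dpush :: "datum \<Rightarrow> datum \<Rightarrow> datum" where "dpush a as \<equiv> prim Push (Lst [a, as])"

lemma computableE: "computable F \<Longrightarrow> (\<And>a. (\<And>x. outputs a x (F x)) \<Longrightarrow> thesis) \<Longrightarrow> thesis"
  unfolding computable_def by blast

lemma computable_id: "computable (\<lambda>x. x)"
  unfolding computable_def by (rule exI[of _ Ident]) simp

lemma computable_const: "computable (\<lambda>x. d)"
  unfolding computable_def by (rule exI[of _ "Const d"]) simp

lemma computable_comp:
  assumes "computable G" "computable F"
  shows "computable (\<lambda>x. G (F x))"
proof -
  obtain g f where "\<And>x. outputs g x (G x)" "\<And>x. outputs f x (F x)"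
    using assms unfolding computable_def by blast
  then show ?thesis unfolding computable_def by (intro exI[of _ "Comp g f"]) auto
qed

lemma computable_prim: "computable F \<Longrightarrow> computable (\<lambda>x. prim p (F x))"
proof (rule computable_comp[of "prim p"])
  show "computable (prim p)" unfolding computable_def by (rule exI[of _ "Opr p"]) simp
qed

lemma computable_dclock: "computable F \<Longrightarrow> computable (\<lambda>x. dclock (F x))"
proof (rule computable_comp[of dclock])
  show "computable dclock" unfolding computable_def using outputs_Clock by blast
qed

lemma computable_pair:
  assumes "computable F" "computable G"
  shows "computable (\<lambda>x. Lst [F x, G x])"
proof -
  obtain g f where "\<And>x. outputs g x (G x)" "\<And>x. outputs f x (F x)"
    using assms unfolding computable_def by blast
  then show ?thesis unfolding computable_def by (intro exI[of _ "Pair f g"]) auto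
qed

lemma computable_Lst_Nil: "computable (\<lambda>x. Lst [])"
  by (rule computable_const)

lemma computable_Lst_Cons:
  assumes "computable F" "computable (\<lambda>x. Lst (G x))"
  shows "computable (\<lambda>x. Lst (F x # G x))"
  using computable_prim[OF computable_pair[OF assms], of Push] by simp

lemma computable_if:
  assumes "computable F" "computable G" "computable P" "computable Q"
  shows "computable (\<lambda>x. if F x = G x then P x else Q x)"
proof -
  have "computable (\<lambda>x. prim Same (Lst [F x, G x]))"
    using assms by (intro computable_prim computable_pair)
  then obtain c p q where c: "\<And>x. outputs c x (prim Same (Lst [F x, G x]))"
    and "\<And>x. outputs p x (P x)" "\<And>x. outputs q x (Q x)"
    using assms unfolding computable_def by blast
  then have "outputs (Cond c p q) x (if F x = G x then P x else Q x)" for x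
    by (auto intro!: exI[of _ "prim Same (Lst [F x, G x])"] c)
      (use c[of x] in \<open>auto simp: split: if_splits\<close>)
  then show ?thesis unfolding computable_def by blast
qed

lemmas computable_intros =
  computable_id computable_const computable_prim computable_dclock
  computable_Lst_Nil computable_Lst_Cons computable_if

lemma computable_foldl:
  assumes "computable (\<lambda>s. G (dhd s) (dhd (dtl s)) (dhd (dtl (dtl s))))"
    and L: "computable L" and A: "computable A" and E: "computable E"
  shows "computable (\<lambda>x. foldl (\<lambda>acc y. G y acc (E x)) (A x) (elems (L x)))"
proof -
  define C where "C s = (if dhd s = dpush (dhd (dhd s)) (dtl (dhd s)) then Num 1 else Num 0)" for s
  define B where "B s = Lst [dtl (dhd s), G (dhd (dhd s)) (dhd (dtl s)) (dhd (dtl (dtl s))), dhd (dtl (dtl s))]"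
    for s
  have "computable C" unfolding C_def
    by (intro computable_intros)
  moreover have "computable B"
  proof -
    have "computable (\<lambda>s. (\<lambda>s. G (dhd s) (dhd (dtl s)) (dhd (dtl (dtl s))))
       (Lst [dhd (dhd s), dhd (dtl s), dhd (dtl (dtl s))]))"
      by (rule computable_comp[OF assms(1)]) (intro computable_intros)
    then have "computable (\<lambda>s. G (dhd (dhd s)) (dhd (dtl s)) (dhd (dtl (dtl s))))" by simp
    then show ?thesis unfolding B_def by (intro computable_intros)
  qed
  ultimately obtain c b where c: "\<And>s. outputs c s (C s)" and b: "\<And>s. outputs b s (B s)"
    unfolding computable_def by blast
  have fold: "outputs (While c b) (Lst [l, acc, e]) (Lst [l', foldl (\<lambda>acc y. G y acc e) acc (elems l), e])
      \<longleftrightarrow> l' = (if elems l = [] then l else Lst [])" for l l' acc e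
  proof (induction "elems l" arbitrary: l acc)
    case Nil
    then have "C (Lst [l, acc, e]) = Num 0" by (cases l) (auto simp: C_def)
    with c[of "Lst [l, acc, e]"] Nil[symmetric] show ?case
      by (subst outputs_While) (auto dest: outputs_det)
  next
    case (Cons d ds)
    then have l: "l = Lst (d # ds)" by (cases l) auto
    have C: "outputs c (Lst [l, acc, e]) (Num 1)"
      using c[of "Lst [l, acc, e]"] l by (auto simp: C_def)
    have B: "outputs b (Lst [l, acc, e]) (Lst [Lst ds, G d acc e, e])"
      using b[of "Lst [l, acc, e]"] l by (auto simp: B_def)
    have "outputs (While c b) (Lst [l, acc, e]) v \<longleftrightarrow>
       outputs (While c b) (Lst [Lst ds, G d acc e, e]) v" for v
      by (subst outputs_While) (use C B in \<open>auto dest: outputs_det\<close>)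
    then show ?case using Cons(1)[of "Lst ds" "G d acc e"] l by simp
  qed
  have "computable (\<lambda>x. Lst [L x, A x, E x])" using L A E by (intro computable_intros)
  then obtain i where i: "\<And>x. outputs i x (Lst [L x, A x, E x])" unfolding computable_def by blast
  have "outputs (Comp (Comp (Opr Hd) (Opr Tl)) (Comp (While c b) i)) x
      (foldl (\<lambda>acc y. G y acc (E x)) (A x) (elems (L x)))" for x
  proof -
    let ?r = "Lst [if elems (L x) = [] then L x else Lst [], foldl (\<lambda>acc y. G y acc (E x)) (A x) (elems (L x)), E x]"
    have "outputs (While c b) (Lst [L x, A x, E x]) ?r" by (rule iffD2[OF fold]) simp
    then have "outputs (Comp (While c b) i) x ?r" using i[of x] by (subst outputs_Comp) blast
    then show ?thesis
      by (subst outputs_Comp) (rule exI[of _ ?r], simp)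
  qed
  then show ?thesis unfolding computable_def by blast
qed


lemma foldl_dpush: "foldl (\<lambda>acc y. dpush y acc) (Lst as) ds = Lst (rev ds @ as)"
  by (induction ds arbitrary: as) auto

lemma computable_rev:
  assumes "computable F"
  shows "computable (\<lambda>x. Lst (rev (elems (F x))))"
proof -
  have "computable (\<lambda>x. foldl (\<lambda>acc y. dpush y acc) (Lst []) (elems (F x)))"
    by (rule computable_foldl[where G = "\<lambda>y acc e. dpush y acc" and E = "\<lambda>x. x"])
      (intro computable_intros assms)+
  then show ?thesis by (simp only: foldl_dpush append_Nil2)
qed

lemma computable_append:
  assumes "computable F" "computable G"
  shows "computable (\<lambda>x. Lst (elems (F x) @ elems (G x)))"
proof -
  have "computable (\<lambda>x. foldl (\<lambda>acc y. dpush y acc) (Lst (rev (elems (Lst (rev (elems (G x)))))))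
      (elems (Lst (rev (elems (F x))))))"
    by (rule computable_foldl[where G = "\<lambda>y acc e. dpush y acc" and E = "\<lambda>x. x"])
      (intro computable_intros computable_rev assms)+
  then show ?thesis by (simp only: foldl_dpush elems.simps rev_rev_ident)
qed

lemma computable_if_member:
  assumes "computable F" "computable L" "computable P" "computable Q"
  shows "computable (\<lambda>x. if F x \<in> set (elems (L x)) then P x else Q x)"
proof -
  have "computable (\<lambda>x. foldl (\<lambda>acc y. if y = F x then Num 1 else acc) (Num 0) (elems (L x)))"
    by (rule computable_foldl[where G = "\<lambda>y acc e. if y = e then Num 1 else acc"])
      (intro computable_intros assms)+
  moreover have "foldl (\<lambda>acc y. if y = z then Num 1 else acc) a ds = (if z \<in> set ds then Num 1 else a)"
    for z :: datum and a ds by (induction ds arbitrary: a) auto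
  ultimately have "computable (\<lambda>x. if F x \<in> set (elems (L x)) then Num 1 else Num 0)"
    by (simp only:)
  then have "computable (\<lambda>x. if (if F x \<in> set (elems (L x)) then Num 1 else Num 0) = Num 1 then P x else Q x)"
    by (intro computable_intros assms)
  moreover have "(if (if c then Num 1 else Num 0) = Num 1 then p else q) = (if c then p else q)"
    for c and p q :: datum by simp
  ultimately show ?thesis by (simp only:)
qed

lemma statements_iff: "A \<in> statements \<longleftrightarrow>
    A = Lst [dhd A, dhd (dtl A), dhd (dtl (dtl A))] \<and> prim Kind (dhd A) = Num 2"
  by (auto simp: statements_def split: datum.splits list.splits)

lemma computable_if_statement:
  assumes "computable F" "computable P" "computable Q"
  shows "computable (\<lambda>x. if F x \<in> statements then P x else Q x)"
proof -
  have "computable (\<lambda>x. if F x = Lst [dhd (F x), dhd (dtl (F x)), dhd (dtl (dtl (F x)))]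
      then if prim Kind (dhd (F x)) = Num 2 then P x else Q x else Q x)"
    by (intro computable_intros assms)
  moreover have "(if F x \<in> statements then P x else Q x) =
     (if F x = Lst [dhd (F x), dhd (dtl (F x)), dhd (dtl (dtl (F x)))]
      then if prim Kind (dhd (F x)) = Num 2 then P x else Q x else Q x)" for x
    unfolding statements_iff by (simp del: prim.simps)
  ultimately show ?thesis by presburger
qed

subsection \<open>Disjunction\<close>

lemma ex_is_or: "\<exists>or_alg. is_or or_alg"
proof -
  define R where "R A k = dclock (Lst [dhd A, dhd (dtl A), k])" for A k
  define O' where "O' s =
    (if R (dhd (dtl s)) (dhd s) = Lst [dhd (dtl (dtl (dhd (dtl s))))] then Num 1
     else if R (dhd (dtl (dtl s))) (dhd s) = Lst [dhd (dtl (dtl (dhd (dtl (dtl s)))))] then Num 1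
     else if R (dhd (dtl s)) (dhd s) = Lst [] then Num 2
     else if R (dhd (dtl (dtl s))) (dhd s) = Lst [] then Num 2 else Num 0)" for s
  define C where "C s = (if O' s = Num 2 then Num 1 else Num 0)" for s
  define N where "N s = Lst [prim Incr (dhd s), dhd (dtl s), dhd (dtl (dtl s))]" for s
  define I where "I x = Lst [Num 0, dhd x, dhd (dtl x)]" for x
  have "computable O'" "computable C" "computable N" "computable I"
    unfolding C_def O'_def R_def N_def I_def by (intro computable_intros)+
  then obtain out c b i where out: "\<And>x. outputs out x (O' x)" and c: "\<And>x. outputs c x (C x)"
    and b: "\<And>x. outputs b x (N x)" and i: "\<And>x. outputs i x (I x)"
    unfolding computable_def by metis
  have "outputs (Comp out (Comp (While c b) i)) (Lst [A, B]) v \<longleftrightarrow>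
      v = Num 1 \<and> (true_stmt A \<or> true_stmt B) \<or> v = Num 0 \<and> directly_false A \<and> directly_false B"
    (is "?L v \<longleftrightarrow> ?R v") if "A \<in> statements" "B \<in> statements" for A B v
  proof -
    obtain \<alpha> u w where A: "A = Lst [Alg \<alpha>, u, w]" using \<open>A \<in> statements\<close> by (auto simp: statements_def)
    obtain \<beta> u' w' where B: "B = Lst [Alg \<beta>, u', w']" using \<open>B \<in> statements\<close> by (auto simp: statements_def)
    define s where "s n = Lst [Num n, A, B]" for n
    have i0: "I (Lst [A, B]) = s 0" by (simp add: I_def s_def)
    have W: "outputs (While c b) (s 0) y \<longleftrightarrow> (\<exists>n. C (s n) = Num 0 \<and> (\<forall>m<n. C (s m) \<noteq> Num 0) \<and> y = s n)" for y
    proof (rule outputs_While_seq)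
      show "outputs c (s n) (C (s n))" for n by (rule c)
      show "outputs b (s n) (s (Suc n))" for n using b[of "s n"] by (simp add: N_def s_def)
    qed
    have L: "?L v \<longleftrightarrow> (\<exists>n. O' (s n) \<noteq> Num 2 \<and> (\<forall>m<n. O' (s m) = Num 2) \<and> v = O' (s n))" for v
    proof -
      have "?L v \<longleftrightarrow> (\<exists>y. outputs (While c b) (s 0) y \<and> v = O' y)"
        using i[of "Lst [A, B]"] out unfolding i0 outputs_Comp by (metis outputs_det)
      moreover have "C (s n) = Num 0 \<longleftrightarrow> O' (s n) \<noteq> Num 2" for n by (simp add: C_def)
      ultimately show ?thesis unfolding W by blast
    qed
    have O': "O' (s n) = (if clocked \<alpha> u n = Lst [w] then Num 1 else if clocked \<beta> u' n = Lst [w'] then Num 1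
        else if clocked \<alpha> u n = Lst [] then Num 2 else if clocked \<beta> u' n = Lst [] then Num 2 else Num 0)" for n
      by (simp add: O'_def s_def R_def A B dclock_def)
    have TA: "true_stmt A \<longleftrightarrow> outputs \<alpha> u w" and TB: "true_stmt B \<longleftrightarrow> outputs \<beta> u' w'"
      and FA: "directly_false A \<longleftrightarrow> (\<exists>z. outputs \<alpha> u z \<and> z \<noteq> w)"
      and FB: "directly_false B \<longleftrightarrow> (\<exists>z. outputs \<beta> u' z \<and> z \<noteq> w')"
      by (auto simp: true_stmt_def directly_false_def A B)
    have LR: "?R (O' (s n))" if "O' (s n) \<noteq> Num 2" for n
    proof (cases "clocked \<alpha> u n = Lst [w] \<or> clocked \<beta> u' n = Lst [w']")
      case True
      then have "O' (s n) = Num 1" unfolding O' by auto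
      then show ?thesis using True unfolding TA TB outputs_clocked by auto
    next
      case False
      with that have n: "clocked \<alpha> u n \<noteq> Lst []" "clocked \<beta> u' n \<noteq> Lst []"
        unfolding O' by (auto split: if_splits)
      then obtain z z' where z: "clocked \<alpha> u n = Lst [z]" "clocked \<beta> u' n = Lst [z']"
        using clocked_cases by meson
      have "O' (s n) = Num 0" unfolding O' using False n by simp
      moreover have "z \<noteq> w" "z' \<noteq> w'" using False z by auto
      ultimately show ?thesis using z unfolding FA FB outputs_clocked by auto
    qed
    show ?thesis
    proof
      show "?R v" if "?L v" using that L LR by metis
    next
      assume R: "?R v"
      have "\<exists>n. O' (s n) \<noteq> Num 2"
      proof (cases "true_stmt A \<or> true_stmt B")
        case True
        then obtain n where "clocked \<alpha> u n = Lst [w] \<or> clocked \<beta> u' n = Lst [w']"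
          unfolding TA TB outputs_clocked by blast
        then show ?thesis unfolding O' by (intro exI[of _ n]) auto
      next
        case False
        with R obtain z z' k l where "clocked \<alpha> u k = Lst [z]" "clocked \<beta> u' l = Lst [z']"
          unfolding FA FB outputs_clocked by blast
        then have "clocked \<alpha> u (max k l) = Lst [z]" "clocked \<beta> u' (max k l) = Lst [z']"
          by (auto elim: clocked_mono)
        then show ?thesis unfolding O' by (intro exI[of _ "max k l"]) auto
      qed
      then obtain n where n: "O' (s n) \<noteq> Num 2" "\<forall>m<n. O' (s m) = Num 2"
        using exists_least_iff[of "\<lambda>n. O' (s n) \<noteq> Num 2"] by blast
      have "?R (O' (s n))" using LR n(1) by blast
      moreover have "\<not> (true_stmt A \<and> directly_false A)" "\<not> (true_stmt B \<and> directly_false B)"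
        unfolding TA TB FA FB by (auto dest: outputs_det)
      ultimately have "v = O' (s n)" using R by auto
      then show "?L v" unfolding L using n by blast
    qed
  qed
  then show ?thesis unfolding is_or_def by blast
qed

subsection \<open>Deduction\<close>

lemma is_library_imp_algorithmic_sequence: "is_library \<rho> \<Longrightarrow> algorithmic_sequence \<rho>"
  unfolding is_library_def algorithmic_sequence_def halts_def by blast

lemma recursive_enumeration_pos:
  assumes "recursive_enumeration f" "i > 0"
  shows "fst (f i) > 0" "snd (f i) > 0"
proof -
  have "f i \<in> {0<..} \<times> {0<..}"
    using assms unfolding recursive_enumeration_def bij_betw_def by auto
  then show "fst (f i) > 0" "snd (f i) > 0" by auto
qed

lemma deduction_Suc_statements:
  assumes f: "recursive_enumeration f" and \<rho>: "is_library \<rho>" and "set \<Gamma> \<subseteq> statements"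
  shows "set (deduction f \<Gamma> \<rho> i) \<subseteq> statements \<and>
    (\<exists>r K. is_rule r \<and> outputs \<rho> (Num (fst (f (Suc i)))) (Alg r) \<and>
      outputs r (rule_input (deduction f \<Gamma> \<rho> i) \<rho> (snd (f (Suc i)))) (Lst (deduction f \<Gamma> \<rho> (Suc i))) \<and>
      deduction f \<Gamma> \<rho> (Suc i) = deduction f \<Gamma> \<rho> i @ K \<and> set K \<subseteq> statements)"
proof -
  have step: "\<exists>r K. is_rule r \<and> outputs \<rho> (Num (fst (f (Suc i)))) (Alg r) \<and>
      outputs r (rule_input (deduction f \<Gamma> \<rho> i) \<rho> (snd (f (Suc i)))) (Lst (deduction f \<Gamma> \<rho> (Suc i))) \<and>
      deduction f \<Gamma> \<rho> (Suc i) = deduction f \<Gamma> \<rho> i @ K \<and> set K \<subseteq> statements"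
    if H: "set (deduction f \<Gamma> \<rho> i) \<subseteq> statements" for i
  proof -
    let ?k = "fst (f (Suc i))" and ?m = "snd (f (Suc i))" and ?H = "deduction f \<Gamma> \<rho> i"
    have pos: "?k > 0" "?m > 0" using recursive_enumeration_pos[OF f] by auto
    obtain r where r: "is_rule r" "outputs \<rho> (Num ?k) (Alg r)"
      using \<rho> pos unfolding is_library_def by blast
    have "is_rule_input ?H \<rho> ?m"
      using H pos is_library_imp_algorithmic_sequence[OF \<rho>] unfolding is_rule_input_def by blast
    then obtain K where K: "set K \<subseteq> statements" "outputs r (rule_input ?H \<rho> ?m) (Lst (?H @ K))"
      using r(1) unfolding is_rule_def by blast
    have "deduction f \<Gamma> \<rho> (Suc i) = ?H @ K"
      unfolding deduction.simps(2)
    proof (rule the_equality)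
      show "\<exists>r. outputs \<rho> (Num ?k) (Alg r) \<and> outputs r (rule_input ?H \<rho> ?m) (Lst (?H @ K))"
        using r K by blast
      show "L = ?H @ K" if "\<exists>r. outputs \<rho> (Num ?k) (Alg r) \<and> outputs r (rule_input ?H \<rho> ?m) (Lst L)" for L
        using that outputs_det[OF r(2)] outputs_det[OF K(2)] by auto
    qed
    then show ?thesis using r K by auto
  qed
  have "set (deduction f \<Gamma> \<rho> i) \<subseteq> statements"
  proof (induction i)
    case (Suc i)
    from step[OF this] Suc show ?case by auto
  qed (use assms(3) in simp)
  with step show ?thesis by blast
qed

lemma deduction_Suc:
  assumes "recursive_enumeration f" "is_library \<rho>" "set \<Gamma> \<subseteq> statements"
  shows "\<exists>r. outputs \<rho> (Num (fst (f (Suc i)))) (Alg r) \<and>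
    outputs r (rule_input (deduction f \<Gamma> \<rho> i) \<rho> (snd (f (Suc i)))) (Lst (deduction f \<Gamma> \<rho> (Suc i)))"
  using deduction_Suc_statements[OF assms] by blast

lemma ex_is_deduce:
  assumes f: "recursive_enumeration f"
  shows "\<exists>ded. is_deduce f ded"
proof -
  obtain \<phi> where \<phi>: "\<And>i. i > 0 \<Longrightarrow> outputs \<phi> (Num i) (Lst [Num (fst (f i)), Num (snd (f i))])"
    using f unfolding recursive_enumeration_def by blast
  define J where "J s = prim Incr (dhd s)" for s
  define Q1 where "Q1 t = Lst [dhd (dtl (dtl (dhd t))), dhd (dhd (dtl t))]" for t
  define Q2 where "Q2 u = Lst [dhd (dtl u), Lst [dhd (dtl (dhd (dhd u))),
      dhd (dtl (dtl (dhd (dhd u)))), dhd (dtl (dhd (dtl (dhd u))))]]" for u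
  define Q3 where "Q3 w = Lst [prim Incr (dhd (dhd (dhd (dhd w)))), dhd (dtl w),
      dhd (dtl (dtl (dhd (dhd (dhd w))))), dhd (dtl (dtl (dtl (dhd (dhd (dhd w))))))]" for w
  define C where "C s = (if dhd (dtl (dtl (dtl s))) \<in> set (elems (dhd (dtl s))) then Num 0 else Num 1)" for s
  define I where "I x = Lst [Num 0, dhd x, dhd (dtl x), dhd (dtl (dtl x))]" for x
  have "computable J" "computable Q1" "computable Q2" "computable Q3" "computable C" "computable I"
    unfolding J_def Q1_def Q2_def Q3_def C_def I_def
    by (intro computable_intros computable_if_member)+
  then obtain j q1 q2 q3 c i where j: "\<And>x. outputs j x (J x)" and q1: "\<And>x. outputs q1 x (Q1 x)"
    and q2: "\<And>x. outputs q2 x (Q2 x)" and q3: "\<And>x. outputs q3 x (Q3 x)"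
    and c: "\<And>x. outputs c x (C x)" and i: "\<And>x. outputs i x (I x)"
    unfolding computable_def by metis
  define b where "b = Comp q3 (Comp (Pair Ident (Comp Apply q2))
     (Comp (Pair Ident (Comp Apply q1)) (Pair Ident (Comp \<phi> j))))"
  define ded where "ded = Comp (Const (Num 1)) (Comp (While c b) i)"
  have "outputs ded (Lst [Lst \<Gamma>, Alg \<rho>, B]) v \<longleftrightarrow> v = Num 1 \<and> (\<exists>i>0. B \<in> set (deduction f \<Gamma> \<rho> i))"
    if \<Gamma>: "set \<Gamma> \<subseteq> statements" and \<rho>: "is_library \<rho>" for \<Gamma> \<rho> B v
  proof -
    define H where "H = deduction f \<Gamma> \<rho>"
    define s where "s n = Lst [Num n, Lst (H n), Alg \<rho>, B]" for n
    have W: "outputs (While c b) (s 0) y \<longleftrightarrow> (\<exists>n. C (s n) = Num 0 \<and> (\<forall>m<n. C (s m) \<noteq> Num 0) \<and> y = s n)" for y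
    proof (rule outputs_While_seq)
      show "outputs c (s n) (C (s n))" for n by (rule c)
      fix n
      let ?k = "fst (f (Suc n))" and ?m = "snd (f (Suc n))"
      obtain r where r: "outputs \<rho> (Num ?k) (Alg r)" "outputs r (rule_input (H n) \<rho> ?m) (Lst (H (Suc n)))"
        using deduction_Suc[OF f \<rho> \<Gamma>] unfolding H_def by blast
      define t where "t = Lst [s n, Lst [Num ?k, Num ?m]]"
      define u where "u = Lst [t, Alg r]"
      define w where "w = Lst [u, Lst (H (Suc n))]"
      have J: "J (s n) = Num (Suc n)" by (simp add: J_def s_def)
      have "outputs (Pair Ident (Comp \<phi> j)) (s n) t"
        using j[of "s n"] \<phi>[of "Suc n"] unfolding J t_def by auto
      moreover have "outputs (Pair Ident (Comp Apply q1)) t u"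
      proof -
        have "Q1 t = Lst [Alg \<rho>, Num ?k]" by (simp add: Q1_def t_def s_def)
        then show ?thesis using q1[of t] r(1) unfolding u_def by auto
      qed
      moreover have "outputs (Pair Ident (Comp Apply q2)) u w"
      proof -
        have "Q2 u = Lst [Alg r, rule_input (H n) \<rho> ?m]"
          by (simp add: Q2_def u_def t_def s_def rule_input_def)
        then show ?thesis using q2[of u] r(2) unfolding w_def by auto
      qed
      moreover have "outputs q3 w (s (Suc n))"
        using q3[of w] by (simp add: Q3_def w_def u_def t_def s_def)
      ultimately show "outputs b (s n) (s (Suc n))"
        unfolding b_def outputs_Comp by blast
    qed
    have "I (Lst [Lst \<Gamma>, Alg \<rho>, B]) = s 0" by (simp add: I_def s_def H_def)
    then have "outputs ded (Lst [Lst \<Gamma>, Alg \<rho>, B]) v \<longleftrightarrow> (\<exists>y. outputs (While c b) (s 0) y) \<and> v = Num 1"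
      using i[of "Lst [Lst \<Gamma>, Alg \<rho>, B]"] unfolding ded_def by (auto dest: outputs_det)
    also have "(\<exists>y. outputs (While c b) (s 0) y) \<longleftrightarrow> (\<exists>n. C (s n) = Num 0)"
      unfolding W using exists_least_iff[of "\<lambda>n. C (s n) = Num 0"] by blast
    also have "(\<exists>n. C (s n) = Num 0) \<longleftrightarrow> (\<exists>n. B \<in> set (H n))"
      by (simp add: C_def s_def)
    also have "\<dots> \<longleftrightarrow> (\<exists>n>0. B \<in> set (H n))"
    proof -
      have "set (H 0) \<subseteq> set (H (Suc 0))"
        using deduction_Suc_statements[OF f \<rho> \<Gamma>, of 0] unfolding H_def by auto
      then show ?thesis by (metis gr0I subsetD zero_less_Suc)
    qed
    finally show ?thesis unfolding H_def by blast
  qed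
  then show ?thesis unfolding is_deduce_def by blast
qed

subsection \<open>The rule for disjunctions\<close>

lemma foldl_collect:
  "\<exists>K. foldl (\<lambda>acc g. if P g then dpush (c g) acc else acc) (Lst L) gs = Lst K \<and>
     set K = set L \<union> {c g | g. g \<in> set gs \<and> P g}"
proof (induction gs arbitrary: L)
  case (Cons g gs)
  show ?case
    using Cons[of "if P g then c g # L else L"] by (cases "P g") (simp_all, fastforce+)
qed simp

lemma ex_implements_P4: "\<exists>r. implements (P4_diagram ded or_alg) r"
proof -
  define imp where "imp A R C = Lst [Alg ded, Lst [Lst [A], R, C], Num 1]" for A R C
  define fA where "fA h = dhd (dhd (dtl h))" for h
  define fB where "fB h = dhd (dtl (dhd (dtl h)))" for h
  define fC where "fC g = dhd (dtl (dtl (dhd (dtl g))))" for g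
  define step where "step g acc e =
    (if dhd e = Lst [Alg or_alg, Lst [fA (dhd e), fB (dhd e)], Num 1] then
     if g = imp (fA (dhd e)) (dhd (dtl (dhd (dtl e)))) (fC g) then
     if imp (fB (dhd e)) (dhd (dtl (dhd (dtl e)))) (fC g) \<in> set (elems (dhd (dhd (dtl e)))) then
     if fA (dhd e) \<in> statements then if fB (dhd e) \<in> statements then if fC g \<in> statements then
       dpush (fC g) acc
     else acc else acc else acc else acc else acc else acc)" for g acc e
  have step: "computable (\<lambda>s. step (dhd s) (dhd (dtl s)) (dhd (dtl (dtl s))))"
    unfolding step_def imp_def fA_def fB_def fC_def
    by (intro computable_intros computable_if_member computable_if_statement)
  define row where "row h acc x = foldl (\<lambda>acc g. step g acc (Lst [h, x])) acc (elems (dhd x))" for h acc x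
  have row: "computable (\<lambda>s. row (dhd s) (dhd (dtl s)) (dhd (dtl (dtl s))))"
    unfolding row_def by (rule computable_foldl[OF step]) (intro computable_intros)+
  define F where "F x = Lst (elems (dhd x) @ elems (foldl (\<lambda>acc h. row h acc x) (Lst []) (elems (dhd x))))" for x
  have "computable F"
    unfolding F_def
    by (intro computable_append computable_intros computable_foldl[where E = "\<lambda>x. x", OF row])
  then obtain r where r: "\<And>x. outputs r x (F x)" unfolding computable_def by blast
  have "\<exists>K. outputs r (rule_input H \<rho> m) (Lst (H @ K)) \<and>
      set K = {Y. \<exists>Xs. (Xs, Y) \<in> P4_diagram ded or_alg \<rho> \<and> set Xs \<subseteq> set H}" for H \<rho> m
  proof -
    let ?x = "rule_input H \<rho> m"
    define P where "P h g \<longleftrightarrow> h = disj or_alg (fA h) (fB h) \<and> g = implies ded (fA h) (Alg \<rho>) (fC g) \<and>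
      implies ded (fB h) (Alg \<rho>) (fC g) \<in> set H \<and> fA h \<in> statements \<and> fB h \<in> statements \<and> fC g \<in> statements"
      for h g
    have step_P: "step g acc (Lst [h, ?x]) = (if P h g then dpush (fC g) acc else acc)" for h g acc
      unfolding step_def P_def imp_def implies_def entails_def disj_def rule_input_def by simp
    have row_P: "\<exists>K. row h (Lst L) ?x = Lst K \<and> set K = set L \<union> {fC g | g. g \<in> set H \<and> P h g}" for h L
      unfolding row_def step_P using foldl_collect[of "P h" fC L H] by (simp add: rule_input_def)
    have "\<exists>K. foldl (\<lambda>acc h. row h acc ?x) (Lst L) hs = Lst K \<and>
        set K = set L \<union> {fC g | h g. h \<in> set hs \<and> g \<in> set H \<and> P h g}" for L hs
    proof (induction hs arbitrary: L)
      case (Cons h hs)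
      obtain K where K: "row h (Lst L) ?x = Lst K" "set K = set L \<union> {fC g | g. g \<in> set H \<and> P h g}"
        using row_P by blast
      obtain K' where "foldl (\<lambda>acc h. row h acc ?x) (Lst K) hs = Lst K'"
        "set K' = set K \<union> {fC g | h g. h \<in> set hs \<and> g \<in> set H \<and> P h g}"
        using Cons by blast
      then show ?case using K by (intro exI[of _ K']) auto
    qed simp
    from this[of "[]" H] obtain K where K: "foldl (\<lambda>acc h. row h acc ?x) (Lst []) H = Lst K"
      "set K = {fC g | h g. h \<in> set H \<and> g \<in> set H \<and> P h g}" by auto
    have "F ?x = Lst (H @ K)" using K(1) by (simp add: F_def rule_input_def)
    moreover have "set K = {Y. \<exists>Xs. (Xs, Y) \<in> P4_diagram ded or_alg \<rho> \<and> set Xs \<subseteq> set H}"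
    proof (intro set_eqI iffI)
      fix Y assume "Y \<in> set K"
      then obtain h g where "Y = fC g" "h \<in> set H" "g \<in> set H" "P h g" unfolding K(2) by blast
      then show "Y \<in> {Y. \<exists>Xs. (Xs, Y) \<in> P4_diagram ded or_alg \<rho> \<and> set Xs \<subseteq> set H}"
        unfolding P4_diagram_def P_def
        by (intro CollectI exI[of _ "[implies ded (fA h) (Alg \<rho>) (fC g), implies ded (fB h) (Alg \<rho>) (fC g),
            disj or_alg (fA h) (fB h)]"]) auto
    next
      fix Y assume "Y \<in> {Y. \<exists>Xs. (Xs, Y) \<in> P4_diagram ded or_alg \<rho> \<and> set Xs \<subseteq> set H}"
      then obtain A B where "A \<in> statements" "B \<in> statements" "Y \<in> statements"
        "implies ded A (Alg \<rho>) Y \<in> set H" "implies ded B (Alg \<rho>) Y \<in> set H" "disj or_alg A B \<in> set H"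
        unfolding P4_diagram_def by auto
      moreover have "fA (disj or_alg A B) = A" "fB (disj or_alg A B) = B" "fC (implies ded A (Alg \<rho>) Y) = Y"
        by (simp_all add: fA_def fB_def fC_def disj_def implies_def entails_def)
      ultimately have "P (disj or_alg A B) (implies ded A (Alg \<rho>) Y)" unfolding P_def by simp
      then show "Y \<in> set K"
        unfolding K(2) using \<open>disj or_alg A B \<in> set H\<close> \<open>implies ded A (Alg \<rho>) Y \<in> set H\<close>
          \<open>fC (implies ded A (Alg \<rho>) Y) = Y\<close> by force
    qed
    ultimately show ?thesis using r by metis
  qed
  then show ?thesis unfolding implements_def by blast
qed

end

theory Submission
  imports Defs
begin

text \<open>
  The law with \<open>A = B\<close> amounts to an internal modus ponens, and this leads to Curry's paradox.
  There are an algorithm \<open>q\<close> and statements \<open>Q\<^sub>\<rho>\<close> about \<open>q\<close> such that \<open>Q\<^sub>\<rho>\<close> is true if and only if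
  \<open>Q\<^sub>\<rho> \<Rightarrow>\<^sub>\<rho> F\<close> is, where \<open>F\<close> is a fixed false statement. Hence the rule inferring
  \<open>Q\<^sub>\<rho> \<Rightarrow>\<^sub>\<rho> F\<close> and \<open>Q\<^sub>\<rho> \<or> Q\<^sub>\<rho>\<close> from \<open>Q\<^sub>\<rho>\<close> is \<open>\<rho>\<close>-valid for every library \<open>\<rho>\<close>, and adding it to a
  stable base gives a valid library \<open>\<rho>\<close>. The law now yields \<open>Q\<^sub>\<rho> \<turnstile>\<^sub>\<rho> F\<close>, so \<open>Q\<^sub>\<rho>\<close> is true, and by
  soundness \<open>F\<close> is true.
\<close>

lemma implies_statement: "implies ded A R C \<in> statements"
  by (simp add: implies_def entails_def statements_def)

lemma disj_statement: "disj or_alg A B \<in> statements"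
  by (simp add: disj_def statements_def)

lemma true_stmt_iff_outputs [simp]: "true_stmt (Lst [Alg a, u, v]) \<longleftrightarrow> outputs a u v"
  by (simp add: true_stmt_def)

lemma true_stmt_entails:
  assumes "is_deduce f ded" "set \<Gamma> \<subseteq> statements" "is_library \<rho>" "B \<in> statements"
  shows "true_stmt (entails ded \<Gamma> (Alg \<rho>) B) \<longleftrightarrow> (\<exists>i>0. B \<in> set (deduction f \<Gamma> \<rho> i))"
  using assms unfolding entails_def is_deduce_def by simp

section \<open>Libraries obtained by adding one rule to a base\<close>

lemma library_insert:
  assumes "is_library \<sigma>" "is_rule r"
  shows "\<exists>\<rho>. is_library \<rho> \<and> rules_of \<rho> = insert r (rules_of \<sigma>)"
proof -
  \<comment> \<open>\<open>Cond\<close> takes its last branch on \<open>Num 0\<close>, so index 1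
    yields \<open>r\<close>, while larger indices are lowered by one and passed to
    \<open>\<sigma>\<close>, which is thus consulted only at positive indices.\<close>
  define \<rho> where "\<rho> = Cond (Opr Decr) (Comp \<sigma> (Opr Decr)) (Const (Alg r))"
  have 1: "outputs \<rho> (Num 1) v \<longleftrightarrow> v = Alg r" for v by (simp add: \<rho>_def)
  have 2: "outputs \<rho> (Num (Suc n)) v \<longleftrightarrow> outputs \<sigma> (Num n) v" if "n > 0" for n v
    using that by (simp add: \<rho>_def)
  have split: "(\<exists>n>0. P n) \<longleftrightarrow> P 1 \<or> (\<exists>n>0. P (Suc n))" for P :: "nat \<Rightarrow> bool"
  proof
    assume "\<exists>n>0. P n"
    then obtain n where n: "n > 0" "P n" by auto
    then obtain k where "n = Suc k" by (cases n) auto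
    with n show "P 1 \<or> (\<exists>n>0. P (Suc n))" by (cases "k = 0") auto
  qed auto
  have "is_library \<rho>"
    unfolding is_library_def
  proof (intro allI impI)
    fix n :: nat
    assume "n > 0"
    then consider "n = 1" | k where "n = Suc k" "k > 0" by (cases n) auto
    then show "\<exists>r. is_rule r \<and> outputs \<rho> (Num n) (Alg r)"
      by cases (use assms 1 2 in \<open>auto simp: is_library_def\<close>)
  qed
  moreover have "rules_of \<rho> = insert r (rules_of \<sigma>)"
    unfolding rules_of_def by (subst split) (auto simp: 1[simplified] 2)
  ultimately show ?thesis by blast
qed

text \<open>A finite base is built up rule by rule from the constant library of \<open>r\<close>,
  which also covers the empty base; a base given by a library takes a single insertion.\<close>

lemma base_library_insert:
  assumes "is_base \<B>" "is_rule r"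
  shows "\<exists>\<rho>. is_library \<rho> \<and> rules_of \<rho> = insert r \<B>"
proof -
  have "\<exists>\<rho>. is_library \<rho> \<and> rules_of \<rho> = insert r F" if "finite F" "\<forall>s\<in>F. is_rule s" for F
    using that
  proof (induction F)
    case empty
    have "is_library (Const (Alg r))" "rules_of (Const (Alg r)) = {r}"
      using assms(2) by (auto simp: is_library_def rules_of_def)
    then show ?case by blast
  next
    case (insert s F)
    then show ?case using library_insert[of _ s] by (metis insertI1 insertI2 insert_commute)
  qed
  then show ?thesis using assms library_insert unfolding is_base_def by blast
qed

section \<open>Stages of a deduction: growth, cut and soundness\<close>

lemma deduction_mono:
  assumes "recursive_enumeration f" "is_library \<rho>" "set \<Gamma> \<subseteq> statements" "i \<le> j"
  shows "set (deduction f \<Gamma> \<rho> i) \<subseteq> set (deduction f \<Gamma> \<rho> j)"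
proof (rule lift_Suc_mono_le)
  show "set (deduction f \<Gamma> \<rho> n) \<subseteq> set (deduction f \<Gamma> \<rho> (Suc n))" for n
    using deduction_Suc_statements[OF assms(1-3), of n] by auto
qed (rule assms(4))

lemma deduction_rule:
  assumes "recursive_enumeration f" "is_library \<rho>" "set \<Gamma> \<subseteq> statements"
    and "f (Suc i) = (k, m)" "outputs \<rho> (Num k) (Alg r)"
  shows "outputs r (rule_input (deduction f \<Gamma> \<rho> i) \<rho> m) (Lst (deduction f \<Gamma> \<rho> (Suc i)))"
  using deduction_Suc[OF assms(1-3), of i] assms(4,5) by (auto dest: outputs_det)

text \<open>Otherwise the infinitely many pairs with first component \<open>k\<close> and second
  component above \<open>m\<close> would all be values of \<open>f\<close> on the finite set
  \<open>{..j}\<close>.\<close>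

lemma enumeration_cofinal:
  assumes f: "recursive_enumeration f" and "k > 0"
  shows "\<exists>i>j. \<exists>m'\<ge>m. f i = (k, m')"
proof (rule ccontr)
  assume none: "\<not> ?thesis"
  have "(\<lambda>n. (k, n)) ` {Suc m..} \<subseteq> f ` {..j}"
  proof
    fix p
    assume "p \<in> (\<lambda>n. (k, n)) ` {Suc m..}"
    then obtain m' where m': "p = (k, m')" "m' \<ge> Suc m" by auto
    then have "p \<in> f ` {0<..}"
      using f \<open>k > 0\<close> unfolding recursive_enumeration_def bij_betw_def by auto
    then obtain i where "f i = (k, m')" using m'(1) by auto
    moreover from this have "\<not> j < i" using none Suc_leD[OF m'(2)] by auto
    ultimately show "p \<in> f ` {..j}"
      unfolding m'(1) by (metis atMost_iff image_eqI linorder_not_le)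
  qed
  then have "finite ((\<lambda>n. (k, n)) ` {Suc m..})" by (rule finite_subset) simp
  then have "finite {Suc m..}" by (rule finite_imageD) (simp add: inj_on_def)
  then show False by (simp add: infinite_Ici)
qed

text \<open>The enumeration reaches every index at which \<open>r\<close> is listed, so every
  deduction over \<open>\<rho>\<close> applies \<open>r\<close> at some stage.\<close>

lemma ex_deduction_rule:
  assumes f: "recursive_enumeration f" and \<rho>: "is_library \<rho>" and \<Gamma>: "set \<Gamma> \<subseteq> statements"
    and r: "r \<in> rules_of \<rho>"
  shows "\<exists>i m. m > 0 \<and>
    outputs r (rule_input (deduction f \<Gamma> \<rho> i) \<rho> m) (Lst (deduction f \<Gamma> \<rho> (Suc i)))"
proof -
  obtain k where k: "k > 0" "outputs \<rho> (Num k) (Alg r)"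
    using r unfolding rules_of_def by blast
  \<comment> \<open>Taking bounds 0 and 1 makes the stage a successor and the resource
    positive.\<close>
  obtain i m where "i > 0" "m \<ge> 1" "f i = (k, m)"
    using enumeration_cofinal[OF f k(1)] by blast
  then obtain j where "f (Suc j) = (k, m)" "m > 0" by (cases i) auto
  with deduction_rule[OF f \<rho> \<Gamma> _ k(2)] show ?thesis by blast
qed

text \<open>Continuing a deduction from stage \<open>j\<^sub>0\<close> misses the initial segment of the enumeration; by
  monotonicity of the rules, it suffices that every rule recurs with arbitrarily large resources.\<close>

lemma deduction_cut:
  assumes f: "recursive_enumeration f" and \<rho>: "is_library \<rho>"
    and \<Gamma>: "set \<Gamma> \<subseteq> statements" and \<Delta>: "set \<Delta> \<subseteq> statements"
    and sub: "set \<Gamma> \<subseteq> set (deduction f \<Delta> \<rho> j\<^sub>0)"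
  shows "\<exists>j. set (deduction f \<Gamma> \<rho> i) \<subseteq> set (deduction f \<Delta> \<rho> j)"
proof (induction i)
  case 0
  then show ?case using sub by auto
next
  case (Suc i)
  then obtain j where j: "set (deduction f \<Gamma> \<rho> i) \<subseteq> set (deduction f \<Delta> \<rho> j)" by blast
  obtain k m where km: "f (Suc i) = (k, m)" by fastforce
  then have pos: "k > 0" "m > 0" using recursive_enumeration_pos[OF f, of "Suc i"] by auto
  obtain r where r: "is_rule r" "outputs \<rho> (Num k) (Alg r)"
    using \<rho> pos unfolding is_library_def by blast
  obtain l m' where l: "l > j" "m' \<ge> m" "f l = (k, m')"
    using enumeration_cofinal[OF f pos(1)] by blast
  then obtain l' where l': "l = Suc l'" "j \<le> l'" by (cases l) auto
  have out: "outputs r (rule_input (deduction f \<Gamma> \<rho> i) \<rho> m) (Lst (deduction f \<Gamma> \<rho> (Suc i)))"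
    "outputs r (rule_input (deduction f \<Delta> \<rho> l') \<rho> m') (Lst (deduction f \<Delta> \<rho> (Suc l')))"
    using deduction_rule[OF f \<rho> \<Gamma> km r(2)] deduction_rule[OF f \<rho> \<Delta> _ r(2)] l l' by auto
  have inp: "is_rule_input (deduction f \<Gamma> \<rho> i) \<rho> m" "is_rule_input (deduction f \<Delta> \<rho> l') \<rho> m'"
    using deduction_Suc_statements[OF f \<rho> \<Gamma>] deduction_Suc_statements[OF f \<rho> \<Delta>]
      is_library_imp_algorithmic_sequence[OF \<rho>] pos l unfolding is_rule_input_def by auto
  have "set (deduction f \<Gamma> \<rho> i) \<subseteq> set (deduction f \<Delta> \<rho> l')"
    using j deduction_mono[OF f \<rho> \<Delta> l'(2)] by blast
  \<comment> \<open>Monotonicity of \<open>r\<close> applies: both deductions give it the same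
    nominal library, and the second gives it at least the hypotheses and the resource of the
    first.\<close>
  then have "set (deduction f \<Gamma> \<rho> (Suc i)) \<subseteq> set (deduction f \<Delta> \<rho> (Suc l'))"
    using r(1) out inp l(2) unfolding is_rule_def by blast
  then show ?case by blast
qed

text \<open>Each stage applies a \<open>\<rho>\<close>-valid rule to a list that is true by
  induction.\<close>

lemma deduction_sound:
  assumes f: "recursive_enumeration f" and \<rho>: "is_library \<rho>" "valid_library \<rho>"
    and \<Gamma>: "set \<Gamma> \<subseteq> statements" "\<forall>A\<in>set \<Gamma>. true_stmt A"
  shows "\<forall>A\<in>set (deduction f \<Gamma> \<rho> i). true_stmt A"
proof (induction i)
  case (Suc i)
  obtain r where r: "outputs \<rho> (Num (fst (f (Suc i)))) (Alg r)"
    "outputs r (rule_input (deduction f \<Gamma> \<rho> i) \<rho> (snd (f (Suc i)))) (Lst (deduction f \<Gamma> \<rho> (Suc i)))"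
    using deduction_Suc[OF f \<rho>(1) \<Gamma>(1)] by blast
  have pos: "fst (f (Suc i)) > 0" "snd (f (Suc i)) > 0"
    using recursive_enumeration_pos[OF f] by auto
  then have "valid_rule \<rho> r"
    using \<rho>(2) r(1) unfolding valid_library_def rules_of_def by blast
  then show ?case using Suc r(2) pos(2) unfolding valid_rule_def by blast
qed (use \<Gamma> in simp)

section \<open>Rules triggered by one statement, and the Curry statement\<close>

lemma ex_rule_append:
  assumes "computable S" "computable K" "\<And>\<rho>. set (elems (K (Alg \<rho>))) \<subseteq> statements"
  shows "\<exists>r. is_rule r \<and> (\<forall>H \<rho> m L. outputs r (rule_input H \<rho> m) (Lst L) \<longleftrightarrow>
    L = (if S (Alg \<rho>) \<in> set H then H @ elems (K (Alg \<rho>)) else H))"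
proof -
  \<comment> \<open>In a rule input, \<open>dhd x\<close> is the hypothesis list and
    \<open>dhd (dtl x)\<close> the nominal library.\<close>
  define F where "F x = (if S (dhd (dtl x)) \<in> set (elems (dhd x))
    then Lst (elems (dhd x) @ elems (K (dhd (dtl x)))) else dhd x)" for x
  have "computable F"
    unfolding F_def
    by (intro computable_if_member computable_append computable_intros
        computable_comp[OF assms(1)] computable_comp[OF assms(2)])
  then obtain r where r: "\<And>x. outputs r x (F x)" unfolding computable_def by blast
  define out where
    "out H \<rho> = (if S (Alg \<rho>) \<in> set H then H @ elems (K (Alg \<rho>)) else H)" for H \<rho>
  have "F (rule_input H \<rho> m) = Lst (out H \<rho>)" for H \<rho> m
    by (simp add: F_def out_def rule_input_def)
  then have out: "outputs r (rule_input H \<rho> m) (Lst L) \<longleftrightarrow> L = out H \<rho>" for H \<rho> m L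
    using r[of "rule_input H \<rho> m"] by (auto dest: outputs_det)
  have "\<exists>K. set K \<subseteq> statements \<and> H @ K = out H \<rho>" for H \<rho>
    using assms(3)[of \<rho>] unfolding out_def by (cases "S (Alg \<rho>) \<in> set H") auto
  \<comment> \<open>This is monotonicity: the appended list depends on the nominal library alone,
    and a larger \<open>H\<close> still contains the trigger.\<close>
  moreover have "set (out H \<rho>) \<subseteq> set (out H' \<rho>)" if "set H \<subseteq> set H'" for H H' \<rho>
    using that by (auto simp: out_def)
  ultimately have "is_rule r" unfolding is_rule_def out by simp
  with out show ?thesis unfolding out_def by blast
qed

text \<open>Self-reference comes from the input, which hands \<open>q\<close> its own code. From
  \<open>x = [q, \<rho>]\<close> the map \<open>G\<close> assembles the statement
  \<open>[q, x, 1]\<close> as hypothesis for \<open>ded\<close>, so \<open>q\<close> can be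
  \<open>Comp ded g\<close> although \<open>g\<close> is built without mentioning
  \<open>q\<close>.\<close>

lemma ex_curry_statement:
  "\<exists>q. \<forall>\<rho> v. outputs q (Lst [Alg q, Alg \<rho>]) v \<longleftrightarrow>
     outputs ded (Lst [Lst [Lst [Alg q, Lst [Alg q, Alg \<rho>], Num 1]], Alg \<rho>, F]) v"
proof -
  define G where "G x = Lst [Lst [Lst [dhd x, x, Num 1]], dhd (dtl x), F]" for x
  have "computable G" unfolding G_def by (intro computable_intros)
  then obtain g where g: "\<And>x. outputs g x (G x)" unfolding computable_def by blast
  have "outputs (Comp ded g) x v \<longleftrightarrow> outputs ded (G x) v" for x v
    using g[of x] by (auto dest: outputs_det)
  then show ?thesis by (intro exI[of _ "Comp ded g"]) (simp add: G_def)
qed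

section \<open>Curry's paradox over a stable base\<close>

lemma no_stable_base_with_disjunction_law:
  assumes f: "recursive_enumeration f" and ded: "is_deduce f ded" and or_alg: "is_or or_alg"
    and stable: "stable \<B>"
    and law: "\<And>\<rho> A B C. \<lbrakk>base_library \<B> \<rho>; A \<in> statements; B \<in> statements; C \<in> statements\<rbrakk> \<Longrightarrow>
      true_stmt (entails ded
        [implies ded A (Alg \<rho>) C, implies ded B (Alg \<rho>) C, disj or_alg A B] (Alg \<rho>) C)"
  shows False
proof -
  define F where "F = Lst [Alg (Const (Num 0)), Num 0, Num 1]"
  have F: "F \<in> statements" "\<not> true_stmt F" by (simp_all add: F_def statements_def)
  obtain q where q: "\<And>\<rho> v. outputs q (Lst [Alg q, Alg \<rho>]) v \<longleftrightarrow>
     outputs ded (Lst [Lst [Lst [Alg q, Lst [Alg q, Alg \<rho>], Num 1]], Alg \<rho>, F]) v"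
    using ex_curry_statement by blast
  define Q where "Q R = Lst [Alg q, Lst [Alg q, R], Num 1]" for R
  have Q: "Q R \<in> statements" for R by (simp add: Q_def statements_def)
  have Q_iff: "true_stmt (Q (Alg \<rho>)) \<longleftrightarrow> true_stmt (implies ded (Q (Alg \<rho>)) (Alg \<rho>) F)" for \<rho>
    by (simp add: Q_def implies_def entails_def q)
  \<comment> \<open>These are the premises of the law for \<open>A = B = Q R\<close> and
    \<open>C = F\<close>, whose first two premises then coincide.\<close>
  define K where "K R = Lst [implies ded (Q R) R F, disj or_alg (Q R) (Q R)]" for R
  have "computable Q" unfolding Q_def by (intro computable_intros)
  moreover have "computable K"
    unfolding K_def implies_def entails_def disj_def Q_def by (intro computable_intros)
  moreover have "set (elems (K (Alg \<rho>))) \<subseteq> statements" for \<rho>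
    by (simp add: K_def implies_statement disj_statement)
  ultimately obtain r where r: "is_rule r" "\<And>H \<rho> m L. outputs r (rule_input H \<rho> m) (Lst L) \<longleftrightarrow>
      L = (if Q (Alg \<rho>) \<in> set H then H @ elems (K (Alg \<rho>)) else H)"
    using ex_rule_append[of Q K] by metis
  have "is_base \<B>" using stable unfolding stable_def by blast
  from base_library_insert[OF this r(1)]
  obtain \<rho> where \<rho>: "is_library \<rho>" "rules_of \<rho> = insert r \<B>" by blast
  let ?Q = "Q (Alg \<rho>)" and ?QF = "implies ded (Q (Alg \<rho>)) (Alg \<rho>) F"
  let ?D = "disj or_alg ?Q ?Q"
  have base: "base_library \<B> \<rho>" using \<rho> unfolding base_library_def by blast
  have "valid_rule \<rho> r"
  proof -
    have "true_stmt ?D" if "true_stmt ?Q"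
      using or_alg Q that unfolding is_or_def disj_def by simp
    then show ?thesis
      unfolding valid_rule_def r(2) using Q_iff by (auto simp: K_def)
  qed
  \<comment> \<open>Outside the base the library contains at most the rule \<open>r\<close>.\<close>
  then have "valid_outside \<B> \<rho>" using \<rho>(2) unfolding valid_outside_def by auto
  then have valid: "valid_library \<rho>" using stable base unfolding stable_def by blast
  have stmts: "set [?Q] \<subseteq> statements" "set [?QF, ?QF, ?D] \<subseteq> statements"
    using Q by (simp_all add: implies_statement disj_statement)
  obtain i where i: "F \<in> set (deduction f [?QF, ?QF, ?D] \<rho> i)"
    using law[OF base Q Q F(1)] true_stmt_entails[OF ded stmts(2) \<rho>(1) F(1)] by blast
  obtain j\<^sub>0 where "set [?QF, ?QF, ?D] \<subseteq> set (deduction f [?Q] \<rho> (Suc j\<^sub>0))"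
  proof -
    have "r \<in> rules_of \<rho>" using \<rho>(2) by blast
    from ex_deduction_rule[OF f \<rho>(1) stmts(1) this] obtain j m where
      "outputs r (rule_input (deduction f [?Q] \<rho> j) \<rho> m) (Lst (deduction f [?Q] \<rho> (Suc j)))"
      by blast
    moreover have "?Q \<in> set (deduction f [?Q] \<rho> j)"
      using deduction_mono[OF f \<rho>(1) stmts(1), of 0 j] by simp
    ultimately have "deduction f [?Q] \<rho> (Suc j) = deduction f [?Q] \<rho> j @ elems (K (Alg \<rho>))"
      unfolding r(2) by simp
    then show ?thesis by (intro that[of j]) (simp add: K_def)
  qed
  \<comment> \<open>The deduction of \<open>F\<close> from the three premises is replayed after the
    stage of the deduction from \<open>?Q\<close> at which \<open>r\<close> has produced
    them.\<close>
  from deduction_cut[OF f \<rho>(1) stmts(2,1) this] i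
  obtain j where "F \<in> set (deduction f [?Q] \<rho> j)" by blast
  \<comment> \<open>One more stage ensures a positive index, since \<open>deduce\<close> tests for
    its goal only after a rule has been applied.\<close>
  then have j: "F \<in> set (deduction f [?Q] \<rho> (Suc j))"
    using deduction_mono[OF f \<rho>(1) stmts(1), of j "Suc j"] by auto
  then have "true_stmt ?QF"
    unfolding implies_def using true_stmt_entails[OF ded stmts(1) \<rho>(1) F(1)] by blast
  then have "true_stmt ?Q" using Q_iff by simp
  then have "true_stmt F"
    using bspec[OF deduction_sound[OF f \<rho>(1) valid stmts(1)] j] by simp
  with F(2) show False by simp
qed

text \<open>The deduction from the premises applies \<open>P4\<close> at some stage; the premises
  are still listed there, with \<open>\<rho>\<close> as the nominal library, so \<open>C\<close> is
  appended.\<close>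

lemma P4_imp_disjunction_law:
  assumes f: "recursive_enumeration f" and ded: "is_deduce f ded"
    and P4: "implements (P4_diagram ded or_alg) P4" "P4 \<in> rules_of \<rho>" and \<rho>: "is_library \<rho>"
    and ABC: "A \<in> statements" "B \<in> statements" "C \<in> statements"
  shows "true_stmt (entails ded
    [implies ded A (Alg \<rho>) C, implies ded B (Alg \<rho>) C, disj or_alg A B] (Alg \<rho>) C)"
proof -
  let ?\<Gamma> = "[implies ded A (Alg \<rho>) C, implies ded B (Alg \<rho>) C, disj or_alg A B]"
  have \<Gamma>: "set ?\<Gamma> \<subseteq> statements" by (simp add: implies_statement disj_statement)
  obtain i m where i: "m > 0"
    "outputs P4 (rule_input (deduction f ?\<Gamma> \<rho> i) \<rho> m) (Lst (deduction f ?\<Gamma> \<rho> (Suc i)))"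
    using ex_deduction_rule[OF f \<rho> \<Gamma> P4(2)] by blast
  have "is_rule_input (deduction f ?\<Gamma> \<rho> i) \<rho> m"
    using deduction_Suc_statements[OF f \<rho> \<Gamma>] is_library_imp_algorithmic_sequence[OF \<rho>] i(1)
    unfolding is_rule_input_def by blast
  then obtain K where
    "outputs P4 (rule_input (deduction f ?\<Gamma> \<rho> i) \<rho> m) (Lst (deduction f ?\<Gamma> \<rho> i @ K))"
    and K: "set K = {Y. \<exists>Xs. (Xs, Y) \<in> P4_diagram ded or_alg \<rho> \<and> set Xs \<subseteq> set (deduction f ?\<Gamma> \<rho> i)}"
    using P4(1) unfolding implements_def by blast
  with i(2) have "deduction f ?\<Gamma> \<rho> (Suc i) = deduction f ?\<Gamma> \<rho> i @ K"
    by (blast dest: outputs_det)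
  moreover have "(?\<Gamma>, C) \<in> P4_diagram ded or_alg \<rho>"
    using ABC unfolding P4_diagram_def by blast
  moreover have "set ?\<Gamma> \<subseteq> set (deduction f ?\<Gamma> \<rho> i)"
    using deduction_mono[OF f \<rho> \<Gamma>, of 0 i] by simp
  ultimately have "C \<in> set (deduction f ?\<Gamma> \<rho> (Suc i))"
    using K by (metis (mono_tags, lifting) UnCI mem_Collect_eq set_append)
  then show ?thesis using true_stmt_entails[OF ded \<Gamma> \<rho> ABC(3)] by blast
qed

theorem corollary14p6:
  fixes f :: "nat \<Rightarrow> nat \<times> nat" and ded or_alg :: alg
  assumes "recursive_enumeration f" and "is_deduce f ded" and "is_or or_alg"
  shows "(\<nexists>\<B>. stable \<B> \<and>
           (\<forall>\<rho>. base_library \<B> \<rho> \<longrightarrow>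
              (\<forall>A\<in>statements. \<forall>B\<in>statements. \<forall>C\<in>statements.
                 true_stmt (entails ded
                   [implies ded A (Alg \<rho>) C, implies ded B (Alg \<rho>) C, disj or_alg A B] (Alg \<rho>) C))))
       \<and> (\<forall>P4. implements (P4_diagram ded or_alg) P4 \<longrightarrow> (\<nexists>\<B>. stable \<B> \<and> P4 \<in> \<B>))"
proof (intro conjI allI impI notI; elim exE conjE)
  fix \<B>
  assume "stable \<B>" and law: "\<forall>\<rho>. base_library \<B> \<rho> \<longrightarrow>
    (\<forall>A\<in>statements. \<forall>B\<in>statements. \<forall>C\<in>statements.
       true_stmt (entails ded
         [implies ded A (Alg \<rho>) C, implies ded B (Alg \<rho>) C, disj or_alg A B] (Alg \<rho>) C))"
  show False
    by (rule no_stable_base_with_disjunction_law[OF assms \<open>stable \<B>\<close>]) (use law in blast)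
next
  fix P4 \<B>
  assume P4: "implements (P4_diagram ded or_alg) P4" "P4 \<in> \<B>" and "stable \<B>"
  show False
  \<comment> \<open>Every library over this base contains \<open>P4\<close> and therefore satisfies
    the law.\<close>
  proof (rule no_stable_base_with_disjunction_law[OF assms \<open>stable \<B>\<close>])
    fix \<rho> A B C
    assume "base_library \<B> \<rho>" "A \<in> statements" "B \<in> statements" "C \<in> statements"
    then show "true_stmt (entails ded
        [implies ded A (Alg \<rho>) C, implies ded B (Alg \<rho>) C, disj or_alg A B] (Alg \<rho>) C)"
      using P4_imp_disjunction_law[OF assms(1,2) P4(1)] P4(2) unfolding base_library_def by blast
  qed
qed

end
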